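(* Let $X$ be a complex Banach space, let $\alpha\ge 0$ be a real number, and let $A\in B(X)$ be an operator whose spectrum consists of one point. Then $$\mathcal{D}_A^{\alpha}(\mathbb{R})=\ker \Delta_A^{[\alpha]+1}.$$ In particular, if $0\le\alpha<1$, then $\mathcal{D}_A^{\alpha}(\mathbb{R})=\{A\}'$.
   Context: $B(X)$ is the algebra of all bounded linear operators on $X$. For $A\in B(X)$ and $\alpha\ge 0$, $\mathcal{D}_A^{\alpha}(\mathbb{R})$ is the set of all $T\in B(X)$ for which there exists a constant $C_T>0$ such that $\|e^{tA}Te^{-tA}\|\le C_T(1+|t|)^{\alpha}$ for all $t\in\mathbb{R}$. $\Delta_A:B(X)\to B(X)$ is the inner derivation $\Delta_A(T)=AT-TA$, and $\Delta_A^n$ is its $n$-th iterate, with $\ker\Delta_A^n=\{T\in B(X):\Delta_A^n(T)=0\}$. $\{A\}'=\{T\in B(X):AT=TA\}$ is the commutant of $A$. $[\alpha]$ is the integer part of $\alpha$. *)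

theory Defs
  imports "HOL-Analysis.Analysis"
begin

text \<open>The norm and the real structure come from \<^class>\<open>banach\<close>; complex scalar
  multiplication extends the real one.\<close>

class complex_banach = banach +
  fixes scaleC :: "complex \<Rightarrow> 'a \<Rightarrow> 'a"  (infixr "*\<^sub>C" 75)
  assumes scaleC_add_right: "c *\<^sub>C (x + y) = c *\<^sub>C x + c *\<^sub>C y"
    and scaleC_add_left: "(c + d) *\<^sub>C x = c *\<^sub>C x + d *\<^sub>C x"
    and scaleC_scaleC: "c *\<^sub>C d *\<^sub>C x = (c * d) *\<^sub>C x"
    and scaleC_of_real: "complex_of_real r *\<^sub>C x = r *\<^sub>R x"
    and norm_scaleC: "norm (c *\<^sub>C x) = cmod c * norm x"

instantiation complex :: complex_banach
begin

definition scaleC_complex :: "complex \<Rightarrow> complex \<Rightarrow> complex"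
  where "scaleC_complex c x = c * x"

instance
  by standard (auto simp: scaleC_complex_def algebra_simps norm_mult scaleR_conv_of_real)

end

text \<open>The library type of bounded linear operators only asks for real linearity, so
  \<open>B(X)\<close> is its subset of complex-linear operators. The norm is the same operator norm.\<close>

definition bops :: "('a::complex_banach \<Rightarrow>\<^sub>L 'a) set"
  where "bops = {T. \<forall>c x. blinfun_apply T (c *\<^sub>C x) = c *\<^sub>C blinfun_apply T x}"

lift_definition scalar_op :: "complex \<Rightarrow> 'a::complex_banach \<Rightarrow>\<^sub>L 'a"
  is "\<lambda>c x. c *\<^sub>C x"
proof -
  fix c :: complex
  have "c *\<^sub>C r *\<^sub>R x = r *\<^sub>R c *\<^sub>C x" for r and x :: 'a
    by (simp add: scaleC_of_real[symmetric] scaleC_scaleC mult.commute)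
  then show "bounded_linear (\<lambda>x::'a. c *\<^sub>C x)"
    by (intro bounded_linear_intro[where K = "cmod c"])
       (simp_all add: scaleC_add_right norm_scaleC mult.commute)
qed

definition op_spectrum :: "('a::complex_banach \<Rightarrow>\<^sub>L 'a) \<Rightarrow> complex set"
  where "op_spectrum A =
    {z. \<not> (\<exists>S\<in>bops. S o\<^sub>L (A - scalar_op z) = id_blinfun
                 \<and> (A - scalar_op z) o\<^sub>L S = id_blinfun)}"

text \<open>The library exponential needs an algebra whose unit has norm 1, which excludes operators
  on the zero space; this is the same power series for operators.\<close>

definition op_power :: "('a::real_normed_vector \<Rightarrow>\<^sub>L 'a) \<Rightarrow> nat \<Rightarrow> 'a \<Rightarrow>\<^sub>L 'a"
  where "op_power A n = ((\<lambda>S. A o\<^sub>L S) ^^ n) id_blinfun"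

definition op_exp :: "('a::banach \<Rightarrow>\<^sub>L 'a) \<Rightarrow> 'a \<Rightarrow>\<^sub>L 'a"
  where "op_exp A = (\<Sum>n. op_power A n /\<^sub>R fact n)"

lemma norm_op_power_le: "norm (op_power A n) \<le> norm A ^ n"
proof (induction n)
  case 0
  then show ?case
    by (simp add: op_power_def) (rule norm_blinfun_bound, auto)
next
  case (Suc n)
  have "norm (op_power A (Suc n)) \<le> norm A * norm (op_power A n)"
    by (simp add: op_power_def norm_blinfun_compose)
  also have "\<dots> \<le> norm A * norm A ^ n"
    by (intro mult_left_mono Suc) simp
  finally show ?case by simp
qed

lemma summable_op_exp: "summable (\<lambda>n. op_power A n /\<^sub>R fact n)"
  for A :: "'a::banach \<Rightarrow>\<^sub>L 'a"
proof (rule summable_comparison_test')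
  show "summable (\<lambda>n. norm A ^ n /\<^sub>R fact n)"
    by (rule summable_exp_generic)
  show "norm (op_power A n /\<^sub>R fact n) \<le> norm A ^ n /\<^sub>R fact n" for n
    using norm_op_power_le[of A n] by (simp add: field_simps)
qed

definition conj_growth :: "('a::complex_banach \<Rightarrow>\<^sub>L 'a) \<Rightarrow> real \<Rightarrow> ('a \<Rightarrow>\<^sub>L 'a) set"
  where "conj_growth A \<alpha> =
    {T \<in> bops. \<exists>C>0. \<forall>t::real.
       norm (op_exp (t *\<^sub>R A) o\<^sub>L T o\<^sub>L op_exp (- (t *\<^sub>R A))) \<le> C * (1 + \<bar>t\<bar>) powr \<alpha>}"

definition inner_derivation ::
    "('a::complex_banach \<Rightarrow>\<^sub>L 'a) \<Rightarrow> ('a \<Rightarrow>\<^sub>L 'a) \<Rightarrow> 'a \<Rightarrow>\<^sub>L 'a"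
  where "inner_derivation A T = (A o\<^sub>L T) - (T o\<^sub>L A)"

definition ker_derivation_power ::
    "('a::complex_banach \<Rightarrow>\<^sub>L 'a) \<Rightarrow> nat \<Rightarrow> ('a \<Rightarrow>\<^sub>L 'a) set"
  where "ker_derivation_power A n = {T \<in> bops. (inner_derivation A ^^ n) T = 0}"

definition commutant :: "('a::complex_banach \<Rightarrow>\<^sub>L 'a) \<Rightarrow> ('a \<Rightarrow>\<^sub>L 'a) set"
  where "commutant A = {T \<in> bops. A o\<^sub>L T = T o\<^sub>L A}"

end

theory Submission
  imports Defs
begin

text \<open>
  Write \<open>f t = e\<^sup>t\<^sup>A T e\<^sup>-\<^sup>t\<^sup>A\<close>. Multiplying the two exponential series gives
  \<open>f t = (\<Sum>n. t\<^sup>n \<Delta>\<^sup>n T / n!)\<close> with \<open>\<Delta>\<close> the inner derivation, so membership in \<open>ker \<Delta>\<^sup>m\<close> says that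
  \<open>f\<close> is a polynomial of degree less than \<open>m\<close>. One inclusion is then immediate, and the other one
  says that polynomial growth on the real line forces the entire function \<open>f\<close> to be a polynomial.
  That fails for general entire functions of exponential type (\<open>sin\<close> is bounded on the line), and
  this is where the spectrum enters.

  If the spectrum of \<open>A\<close> is \<open>{z}\<close>, then \<open>Q = A - z\<close> is quasinilpotent: for every \<open>\<epsilon> > 0\<close> the powers
  satisfy \<open>\<parallel>Q\<^sup>n\<parallel> \<le> C \<epsilon>\<^sup>n\<close> (\<open>spectrum_singleton_power_bound\<close>). Scalars commute with \<open>T\<close>, so
  \<open>A\<close> and \<open>Q\<close> induce the same iterates \<open>\<Delta>\<^sup>n T\<close>, and the binomial expansion of \<open>\<Delta>\<^sup>n T\<close> transfers the
  bound: \<open>f\<close> has exponential type zero (\<open>minimal_type_conjugation\<close>).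

  A function of exponential type zero with polynomial growth on the line is a polynomial
  (\<open>polynomial_growth_imp_polynomial\<close>). After subtracting a Taylor polynomial and dividing by a power
  of \<open>t\<close> it suffices that a bounded one is constant. On \<open>[-R, R]\<close> such a function is, up to a
  geometrically small error, a polynomial of degree \<open>N\<close>, where \<open>N / R\<close> may be taken as small as
  desired; a Bernstein inequality bounds its derivative at 0 by a multiple of \<open>N / R\<close>. The
  inequality is obtained from an explicit quadrature formula for \<open>p'(0)\<close> whose weights come from
  the Fejer kernel. Being a finite linear combination of values, it applies verbatim to functions
  with values in a Banach space, so that neither functionals nor complex path integrals occur.

  The quasinilpotence estimate is reached in the same spirit: the mean of the resolvent over the
  \<open>n\<close>-th roots of unity, scaled to radius \<open>r\<close>, is the inverse of \<open>1 - r\<^sup>n Q\<^sup>n\<close>, and on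
  bounded sets of radii these means depend on \<open>r\<close> with a Lipschitz constant independent of \<open>n\<close>.
  This lets the set of radii with \<open>r\<^sup>n Q\<^sup>n \<longrightarrow> 0\<close> be extended in steps of constant size.
\<close>

section \<open>A quadrature formula for the derivative at the origin\<close>

lemma sum_cis_roots_of_unity:
  fixes m :: int
  assumes "P > 0"
  shows "(\<Sum>j<P. cis (of_int m * (2 * pi * real j / real P)))
    = (if int P dvd m then of_nat P else 0)"
proof -
  define \<omega> where "\<omega> = cis (2 * pi * of_int m / real P)"
  have pow: "cis (of_int m * (2 * pi * real j / real P)) = \<omega> ^ j" for j
    by (simp add: \<omega>_def Complex.DeMoivre mult_ac)
  have "\<omega> ^ P = cis (2 * pi * of_int m)"
    using assms by (simp add: \<omega>_def Complex.DeMoivre)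
  then have root: "\<omega> ^ P = 1"
    by (simp add: cis_multiple_2pi)
  have "\<omega> = 1 \<longleftrightarrow> int P dvd m"
  proof
    assume "\<omega> = 1"
    then have "cos (2 * pi * of_int m / real P) = 1"
      by (simp add: \<omega>_def complex_eq_iff)
    then obtain x :: int where "2 * pi * of_int m / real P = of_int x * 2 * pi"
      by (subst (asm) cos_one_2pi_int) blast
    then have "of_int m = real_of_int (x * int P)"
      using assms by (simp add: field_simps)
    then show "int P dvd m"
      by (metis dvd_triv_right of_int_eq_iff)
  next
    assume "int P dvd m"
    then obtain x where "m = int P * x" ..
    then have "2 * pi * of_int m / real P = 2 * pi * of_int x"
      using assms by simp
    then have "\<omega> = cis (2 * pi * of_int x)"
      by (simp only: \<omega>_def)
    then show "\<omega> = 1"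
      by (simp add: cis_multiple_2pi)
  qed
  moreover have "(\<Sum>j<P. \<omega> ^ j) = 0" if "\<omega> \<noteq> 1"
    using that root by (simp add: sum_gp_strict)
  ultimately show ?thesis
    unfolding pow by auto
qed

text \<open>
  The quadrature formula uses \<open>4 N\<close> equally spaced angles. The trigonometric polynomials integrated
  below have frequencies of absolute value less than \<open>4 N\<close>, so summation over the nodes detects
  frequency 0 without aliasing.
\<close>

definition node :: "nat \<Rightarrow> nat \<Rightarrow> real"
  where "node N j = 2 * pi * real j / real (4 * N)"

definition dirichlet :: "nat \<Rightarrow> real \<Rightarrow> complex"
  where "dirichlet N \<theta> = (\<Sum>a<N. cis (real a * \<theta>))"

text \<open>
  The square of the modulus of the Dirichlet sum is \<open>N\<close> times the Fejer kernel, whose Fourier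
  coefficients form a triangle supported on \<open>[-N, N]\<close>. Multiplication by \<open>sin (N \<theta>)\<close> produces the
  difference of two copies of that triangle, shifted by \<open>N\<close> and \<open>-N\<close>; between the two peaks this
  difference is linear in the frequency, as is the action of differentiation on exponentials.
\<close>

definition weight :: "nat \<Rightarrow> nat \<Rightarrow> real"
  where "weight N j = sin (real N * node N j) * (cmod (dirichlet N (node N j)))\<^sup>2 / real (2 * N)"

lemma fejer_kernel_expansion:
  "complex_of_real ((cmod (dirichlet N \<theta>))\<^sup>2)
    = (\<Sum>a<N. \<Sum>b<N. cis (of_int (int a - int b) * \<theta>))"
proof -
  have "complex_of_real ((cmod (dirichlet N \<theta>))\<^sup>2) = dirichlet N \<theta> * cnj (dirichlet N \<theta>)"
    by (simp add: complex_norm_square[symmetric])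
  also have "\<dots> = (\<Sum>a<N. \<Sum>b<N. cis (of_int (int a - int b) * \<theta>))"
    by (simp add: dirichlet_def cnj_sum sum_product cis_cnj cis_mult algebra_simps)
  finally show ?thesis .
qed

lemma sum_cis_node:
  assumes "N > 0"
  shows "(\<Sum>j<4 * N. cis (of_int m * node N j)) = (if int (4 * N) dvd m then of_nat (4 * N) else 0)"
  unfolding node_def using sum_cis_roots_of_unity[of "4 * N" m] assms by simp

text \<open>
  Up to the factor \<open>4 N\<close> this is the Fourier coefficient of \<open>|D|\<^sup>2\<close> at frequency \<open>-c\<close>, that is, the
  number of pairs \<open>a, b < N\<close> with \<open>b - a = c\<close>.
\<close>

lemma sum_fejer_shifted:
  fixes c :: int
  assumes "N > 0" and "\<bar>c\<bar> \<le> 2 * int N"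
  shows "(\<Sum>j<4 * N. of_real ((cmod (dirichlet N (node N j)))\<^sup>2) * cis (of_int c * node N j))
    = of_nat (4 * N) * of_int (max 0 (int N - \<bar>c\<bar>))"
proof -
  have "(\<Sum>j<4 * N. of_real ((cmod (dirichlet N (node N j)))\<^sup>2) * cis (of_int c * node N j))
      = (\<Sum>j<4 * N. \<Sum>a<N. \<Sum>b<N. cis (of_int (int a - int b + c) * node N j))"
    unfolding fejer_kernel_expansion
    by (simp add: sum_distrib_right cis_mult distrib_right)
  also have "\<dots> = (\<Sum>a<N. \<Sum>j<4 * N. \<Sum>b<N. cis (of_int (int a - int b + c) * node N j))"
    by (rule sum.swap)
  also have "\<dots> = (\<Sum>a<N. \<Sum>b<N. \<Sum>j<4 * N. cis (of_int (int a - int b + c) * node N j))"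
    by (intro sum.cong refl sum.swap)
  also have "\<dots> = (\<Sum>a<N. \<Sum>b<N. if int b = int a + c then of_nat (4 * N) else 0)"
  proof (intro sum.cong refl)
    fix a b assume "a \<in> {..<N}" "b \<in> {..<N}"
    \<comment> \<open>At most \<open>3 N - 1\<close>, so divisibility by \<open>4 N\<close> means vanishing.\<close>
    then have "\<bar>int a - int b + c\<bar> < int (4 * N)"
      using assms by auto
    then have "int (4 * N) dvd int a - int b + c \<longleftrightarrow> int a - int b + c = 0"
      using zdvd_not_zless[of "\<bar>int a - int b + c\<bar>" "int (4 * N)"] by auto
    then show "(\<Sum>j<4 * N. cis (of_int (int a - int b + c) * node N j))
        = (if int b = int a + c then of_nat (4 * N) else 0)"
      by (subst sum_cis_node[OF assms(1)]) auto
  qed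
  also have "\<dots> = (\<Sum>a<N. if 0 \<le> int a + c \<and> int a + c < int N then of_nat (4 * N) else 0)"
  proof (intro sum.cong refl)
    fix a assume "a \<in> {..<N}"
    have "{b. b < N \<and> int b = int a + c}
        = (if 0 \<le> int a + c \<and> int a + c < int N then {nat (int a + c)} else {})"
      by auto
    then show "(\<Sum>b<N. if int b = int a + c then of_nat (4 * N) else 0)
        = (if 0 \<le> int a + c \<and> int a + c < int N then of_nat (4 * N) else (0::complex))"
      by (simp add: sum.If_cases lessThan_def Int_def del: of_nat_mult)
  qed
  also have "\<dots> = of_nat (4 * N) * of_nat (card {a. a < N \<and> 0 \<le> int a + c \<and> int a + c < int N})"
    by (simp add: sum.If_cases lessThan_def Int_def)
  also have "{a. a < N \<and> 0 \<le> int a + c \<and> int a + c < int N}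
      = {nat (max 0 (- c))..<nat (min (int N) (int N - c))}"
    by auto
  also have "of_nat (card \<dots>) = (of_int (max 0 (int N - \<bar>c\<bar>)) :: complex)"
  proof -
    have "int (card {nat (max 0 (- c))..<nat (min (int N) (int N - c))}) = max 0 (int N - \<bar>c\<bar>)"
      by auto
    then show ?thesis
      by (metis of_int_of_nat_eq)
  qed
  finally show ?thesis .
qed

text \<open>
  Positivity of the Fejer kernel is what makes this linear in \<open>N\<close>: with \<open>|sin| \<le> 1\<close> the sum of the
  absolute values is at most a multiple of the mean of the kernel, which is known exactly.
\<close>

lemma sum_abs_weight_le:
  assumes "N > 0"
  shows "(\<Sum>j<4 * N. \<bar>weight N j\<bar>) \<le> 2 * real N"
proof -
  have "complex_of_real (\<Sum>j<4 * N. (cmod (dirichlet N (node N j)))\<^sup>2) = of_real (4 * real N * real N)"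
    using sum_fejer_shifted[OF assms, of 0] by simp
  then have parseval: "(\<Sum>j<4 * N. (cmod (dirichlet N (node N j)))\<^sup>2) = 4 * real N * real N"
    by (simp only: of_real_eq_iff)
  have "\<bar>weight N j\<bar> \<le> (cmod (dirichlet N (node N j)))\<^sup>2 / (2 * real N)" for j
    by (auto simp: weight_def abs_mult intro!: divide_right_mono mult_left_le_one_le)
  then have "(\<Sum>j<4 * N. \<bar>weight N j\<bar>)
      \<le> (\<Sum>j<4 * N. (cmod (dirichlet N (node N j)))\<^sup>2 / (2 * real N))"
    by (intro sum_mono)
  also have "\<dots> = 2 * real N"
    using assms by (simp add: parseval flip: sum_divide_distrib)
  finally show ?thesis .
qed

text \<open>
  The quadrature differentiates exponentials of frequency at most \<open>N\<close> at the angle 0. By the Euler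
  formula for \<open>sin (N \<theta>)\<close> the sum is a difference of two triangle values, and
  \<open>(N - |k + N|)\<^sup>+ - (N - |k - N|)\<^sup>+ = -k\<close> in this range.
\<close>

lemma sum_weight_cis:
  fixes k :: int
  assumes "N > 0" and "\<bar>k\<bar> \<le> int N"
  shows "(\<Sum>j<4 * N. of_real (weight N j) * cis (of_int k * node N j)) = \<i> * of_int k"
proof -
  let ?F = "\<lambda>c. \<Sum>j<4 * N. of_real ((cmod (dirichlet N (node N j)))\<^sup>2) * cis (of_int c * node N j)"
  have sin_cis: "complex_of_real (sin x) = (cis x - cis (- x)) / (2 * \<i>)" for x
    by (simp add: complex_eq_iff)
  have "of_real (weight N j) * cis (of_int k * node N j)
      = (of_real ((cmod (dirichlet N (node N j)))\<^sup>2) * cis (of_int (k + int N) * node N j)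
        - of_real ((cmod (dirichlet N (node N j)))\<^sup>2) * cis (of_int (k - int N) * node N j))
        / (4 * \<i> * of_nat N)" for j
  proof -
    have "cis (of_int (k + int N) * node N j) = cis (real N * node N j) * cis (of_int k * node N j)"
      "cis (of_int (k - int N) * node N j) = cis (- (real N * node N j)) * cis (of_int k * node N j)"
      by (simp_all add: cis_mult algebra_simps)
    then show ?thesis
      using assms(1) by (simp add: weight_def sin_cis field_simps)
  qed
  then have "(\<Sum>j<4 * N. of_real (weight N j) * cis (of_int k * node N j))
      = (?F (k + int N) - ?F (k - int N)) / (4 * \<i> * of_nat N)"
    by (simp only: sum_subtractf flip: sum_divide_distrib)
  also have "\<dots> = of_nat (4 * N)
      * of_int (max 0 (int N - \<bar>k + int N\<bar>) - max 0 (int N - \<bar>k - int N\<bar>)) / (4 * \<i> * of_nat N)"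
    using assms by (subst (1 2) sum_fejer_shifted) (simp_all add: algebra_simps)
  also have "max 0 (int N - \<bar>k + int N\<bar>) - max 0 (int N - \<bar>k - int N\<bar>) = - k"
    using assms(2) by auto
  also have "of_nat (4 * N) * of_int (- k) / (4 * \<i> * of_nat N) = \<i> * of_int k"
    using assms(1) by (simp add: field_simps)
  finally show ?thesis .
qed

text \<open>
  The right-hand side is the derivative at 0 of \<open>e\<^sup>i\<^sup>k\<^sup>\<theta> sin\<^sup>n \<theta>\<close>. The extra exponential factor makes the
  induction on \<open>n\<close> work: one sine is traded for a shift of \<open>k\<close> by one in either direction.
\<close>

lemma sum_weight_cis_sin_power:
  fixes k :: int
  assumes "N > 0" and "\<bar>k\<bar> + int n \<le> int N"
  shows "(\<Sum>j<4 * N. of_real (weight N j) * (cis (of_int k * node N j) * of_real (sin (node N j)) ^ n))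
    = (if n = 0 then \<i> * of_int k else if n = 1 then 1 else 0)"
  using assms(2)
proof (induction n arbitrary: k)
  case 0
  then show ?case
    using sum_weight_cis[OF assms(1), of k] by simp
next
  case (Suc n)
  let ?S = "\<lambda>k. \<Sum>j<4 * N. of_real (weight N j)
    * (cis (of_int k * node N j) * of_real (sin (node N j)) ^ n)"
  have step: "cis (of_int k * x) * of_real (sin x) ^ Suc n
      = (cis (of_int (k + 1) * x) * of_real (sin x) ^ n
        - cis (of_int (k - 1) * x) * of_real (sin x) ^ n) / (2 * \<i>)" for x
  proof -
    have "cis (of_int k * x) * of_real (sin x) = (cis (of_int k * x + x) - cis (of_int k * x - x)) / (2 * \<i>)"
      by (simp add: complex_eq_iff cos_add sin_add cos_diff sin_diff)
    moreover have "of_int k * x + x = of_int (k + 1) * x" "of_int k * x - x = of_int (k - 1) * x"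
      by (simp_all add: algebra_simps)
    ultimately have "cis (of_int k * x) * of_real (sin x)
        = (cis (of_int (k + 1) * x) - cis (of_int (k - 1) * x)) / (2 * \<i>)"
      by simp
    then show ?thesis
      by (simp add: mult.assoc[symmetric]) (simp add: left_diff_distrib)
  qed
  have "(\<Sum>j<4 * N. of_real (weight N j)
      * (cis (of_int k * node N j) * of_real (sin (node N j)) ^ Suc n))
      = (?S (k + 1) - ?S (k - 1)) / (2 * \<i>)"
    unfolding step by (simp only: right_diff_distrib times_divide_eq_right sum_subtractf flip: sum_divide_distrib)
  also have "?S (k + 1) = (if n = 0 then \<i> * of_int (k + 1) else if n = 1 then 1 else 0)"
    using Suc.prems by (intro Suc.IH) auto
  also have "?S (k - 1) = (if n = 0 then \<i> * of_int (k - 1) else if n = 1 then 1 else 0)"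
    using Suc.prems by (intro Suc.IH) auto
  finally show ?case
    by (auto simp: algebra_simps)
qed

text \<open>
  With \<open>x = R sin \<theta>\<close> this extracts the linear coefficient of a polynomial of degree at most \<open>N\<close>
  from its values on \<open>[-R, R]\<close>.
\<close>

lemma sum_weight_sin_power:
  assumes "N > 0" and "n \<le> N"
  shows "(\<Sum>j<4 * N. weight N j * sin (node N j) ^ n) = (if n = 1 then 1 else 0)"
proof -
  have "complex_of_real (\<Sum>j<4 * N. weight N j * sin (node N j) ^ n) = of_real (if n = 1 then 1 else 0)"
    using sum_weight_cis_sin_power[OF assms(1), of 0 n] assms(2) by simp
  then show ?thesis
    by (simp only: of_real_eq_iff)
qed

section \<open>Entire functions of exponential type zero on the real line\<close>

text \<open>
  In terms of Taylor coefficients, this says that the entire function \<open>\<Sum>n. t\<^sup>n b\<^sub>n\<close> has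
  exponential type zero.
\<close>

definition minimal_type :: "(nat \<Rightarrow> 'b::banach) \<Rightarrow> bool"
  where "minimal_type b \<longleftrightarrow> (\<forall>\<epsilon>>0. \<exists>C. \<forall>n. fact n * norm (b n) \<le> C * \<epsilon> ^ n)"

lemma minimal_type_shift:
  assumes "minimal_type b"
  shows "minimal_type (\<lambda>n. b (n + m))"
  unfolding minimal_type_def
proof (intro allI impI)
  fix \<epsilon> :: real assume "\<epsilon> > 0"
  then obtain C where C: "fact n * norm (b n) \<le> C * \<epsilon> ^ n" for n
    using assms unfolding minimal_type_def by blast
  have "fact n * norm (b (n + m)) \<le> (C * \<epsilon> ^ m) * \<epsilon> ^ n" for n
  proof -
    have "fact n * norm (b (n + m)) \<le> fact (n + m) * norm (b (n + m))"
      by (intro mult_right_mono fact_mono) auto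
    also have "\<dots> \<le> C * \<epsilon> ^ (n + m)"
      by (rule C)
    finally show ?thesis
      by (simp add: power_add mult_ac)
  qed
  then show "\<exists>C. \<forall>n. fact n * norm (b (n + m)) \<le> C * \<epsilon> ^ n"
    by blast
qed

lemma minimal_type_summable_norm:
  assumes "minimal_type b"
  shows "summable (\<lambda>n. norm (b n) * r ^ n)"
proof -
  obtain C where C: "fact n * norm (b n) \<le> C * 1 ^ n" for n
    using assms unfolding minimal_type_def by (meson zero_less_one)
  have "summable (\<lambda>n. C * (\<bar>r\<bar> ^ n /\<^sub>R fact n))"
    by (intro summable_mult summable_exp_generic)
  then show ?thesis
  proof (rule summable_comparison_test')
    fix n
    have "norm (b n) \<le> C / fact n"
      using C[of n] by (simp add: field_simps)
    then have "norm (b n) * \<bar>r\<bar> ^ n \<le> C / fact n * \<bar>r\<bar> ^ n"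
      by (intro mult_right_mono) auto
    then show "norm (norm (b n) * r ^ n) \<le> C * (\<bar>r\<bar> ^ n /\<^sub>R fact n)"
      by (simp add: abs_mult power_abs field_simps)
  qed
qed

lemma minimal_type_sums:
  assumes "minimal_type b"
  shows "(\<lambda>n. t ^ n *\<^sub>R b n) sums (\<Sum>n. t ^ n *\<^sub>R b n)"
proof (rule summable_sums[OF summable_norm_cancel])
  show "summable (\<lambda>n. norm (t ^ n *\<^sub>R b n))"
    using minimal_type_summable_norm[OF assms, of "\<bar>t\<bar>"]
    by (simp add: power_abs mult.commute)
qed

text \<open>
  Bernstein's inequality at the origin. Applying the quadrature formula to the whole series on
  \<open>[-R, R]\<close> is exact up to degree \<open>N\<close>, and on the remaining terms it costs at most the sum of the
  absolute weights.
\<close>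

lemma first_coefficient_bound:
  fixes b :: "nat \<Rightarrow> 'b::banach"
  assumes "minimal_type b" and "N > 0" and "R > 0"
    and bound: "\<And>t. norm (\<Sum>n. t ^ n *\<^sub>R b n) \<le> M"
  shows "R * norm (b 1) \<le> 2 * real N * (M + (\<Sum>n. norm (b (n + Suc N)) * R ^ (n + Suc N)))"
proof -
  define h where "h = (\<lambda>t. \<Sum>n. t ^ n *\<^sub>R b n)"
  define c where "c = (\<lambda>n. ((\<Sum>j<4 * N. weight N j * sin (node N j) ^ n) * R ^ n) *\<^sub>R b n)"
  define L where "L = (\<Sum>j<4 * N. weight N j *\<^sub>R h (R * sin (node N j)))"
  have "(\<lambda>n. \<Sum>j<4 * N. weight N j *\<^sub>R ((R * sin (node N j)) ^ n *\<^sub>R b n)) sums L"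
    unfolding L_def h_def by (intro sums_sum sums_scaleR_right minimal_type_sums assms)
  moreover have "(\<lambda>n. \<Sum>j<4 * N. weight N j *\<^sub>R ((R * sin (node N j)) ^ n *\<^sub>R b n)) = c"
    unfolding c_def sum_distrib_right scaleR_sum_left by (simp add: power_mult_distrib mult_ac)
  ultimately have "c sums L"
    by simp
  have head: "(\<Sum>n<Suc N. c n) = R *\<^sub>R b 1"
  proof -
    have "(\<Sum>n<Suc N. c n) = (\<Sum>n<Suc N. if n = 1 then R *\<^sub>R b 1 else 0)"
      using assms(2) by (intro sum.cong) (auto simp: c_def sum_weight_sin_power)
    then show ?thesis
      using assms(2) by simp
  qed
  have weights: "\<bar>\<Sum>j<4 * N. weight N j * sin (node N j) ^ n\<bar> \<le> 2 * real N" for n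
  proof -
    have "\<bar>weight N j * sin (node N j) ^ n\<bar> \<le> \<bar>weight N j\<bar>" for j
      by (simp add: abs_mult power_abs mult_left_le power_le_one)
    then have "\<bar>\<Sum>j<4 * N. weight N j * sin (node N j) ^ n\<bar> \<le> (\<Sum>j<4 * N. \<bar>weight N j\<bar>)"
      by (intro order_trans[OF sum_abs] sum_mono)
    then show ?thesis
      using sum_abs_weight_le[OF assms(2)] by linarith
  qed
  have c_le: "norm (c n) \<le> 2 * real N * (norm (b n) * R ^ n)" for n
  proof -
    have "norm (c n) = \<bar>\<Sum>j<4 * N. weight N j * sin (node N j) ^ n\<bar> * (norm (b n) * R ^ n)"
      using assms(3) by (simp add: c_def abs_mult)
    also have "\<dots> \<le> 2 * real N * (norm (b n) * R ^ n)"
      using weights assms(3) by (intro mult_right_mono) auto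
    finally show ?thesis .
  qed
  have summ: "summable (\<lambda>n. norm (b (n + Suc N)) * R ^ (n + Suc N))"
    using minimal_type_summable_norm[OF assms(1), of R]
    by (subst summable_iff_shift[where f = "\<lambda>n. norm (b n) * R ^ n"])
  have tail: "norm (\<Sum>n. c (n + Suc N))
      \<le> (\<Sum>n. 2 * real N * (norm (b (n + Suc N)) * R ^ (n + Suc N)))"
    by (rule norm_suminf_le[OF c_le]) (intro summable_mult summ)
  have "norm L \<le> (\<Sum>j<4 * N. \<bar>weight N j\<bar> * M)"
    unfolding L_def using bound by (intro sum_norm_le) (simp add: h_def mult_left_mono)
  also have "\<dots> \<le> 2 * real N * M"
    using order_trans[OF norm_ge_zero bound] sum_abs_weight_le[OF assms(2)]
    by (simp add: mult_right_mono flip: sum_distrib_right)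
  finally have L_le: "norm L \<le> 2 * real N * M" .
  have "L = (\<Sum>n. c (n + Suc N)) + R *\<^sub>R b 1"
    using suminf_split_initial_segment[OF sums_summable[OF \<open>c sums L\<close>], of "Suc N"]
      sums_unique[OF \<open>c sums L\<close>] head by simp
  then have "R *\<^sub>R b 1 = L - (\<Sum>n. c (n + Suc N))"
    by simp
  then have "norm (R *\<^sub>R b 1) \<le> norm L + norm (\<Sum>n. c (n + Suc N))"
    using norm_triangle_ineq4 by metis
  also have "\<dots> \<le> 2 * real N * M + (\<Sum>n. 2 * real N * (norm (b (n + Suc N)) * R ^ (n + Suc N)))"
    by (intro add_mono L_le tail)
  also have "\<dots> = 2 * real N * (M + (\<Sum>n. norm (b (n + Suc N)) * R ^ (n + Suc N)))"
    by (simp only: suminf_mult[OF summ] distrib_left)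
  finally have "norm (R *\<^sub>R b 1)
      \<le> 2 * real N * (M + (\<Sum>n. norm (b (n + Suc N)) * R ^ (n + Suc N)))" .
  moreover have "norm (R *\<^sub>R b 1) = R * norm (b 1)"
    using assms(3) by simp
  ultimately show ?thesis
    by (simp only:)
qed

lemma power_self_le_fact: "real n ^ n \<le> 3 ^ n * fact n"
proof -
  have "real n ^ n / fact n = (\<Sum>k\<in>{n}. real n ^ k /\<^sub>R fact k)"
    by (simp add: field_simps)
  also have "\<dots> \<le> (\<Sum>k. real n ^ k /\<^sub>R fact k)"
    by (intro sum_le_suminf summable_exp_generic) auto
  also have "\<dots> = exp (real n)"
    by (simp only: exp_def)
  also have "\<dots> = exp 1 ^ n"
    using exp_of_nat_mult[of n "1::real"] by simp
  also have "\<dots> \<le> 3 ^ n"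
    by (intro power_mono exp_le) auto
  finally show ?thesis
    by (simp add: field_simps)
qed

text \<open>
  In the Bernstein bound take \<open>R = N / (6 \<epsilon>)\<close> with \<open>\<epsilon>\<close> fixed. By \<open>n\<^sup>n \<le> 3\<^sup>n n!\<close> the type condition
  makes the terms beyond degree \<open>N\<close> at most \<open>C 2\<^sup>-\<^sup>n\<close>, so letting \<open>N\<close> tend to infinity leaves
  \<open>12 \<epsilon> M\<close>, and \<open>\<epsilon>\<close> is arbitrary.
\<close>

lemma bounded_minimal_type_first_coefficient:
  fixes b :: "nat \<Rightarrow> 'b::banach"
  assumes "minimal_type b" and bound: "\<And>t. norm (\<Sum>n. t ^ n *\<^sub>R b n) \<le> M"
  shows "b 1 = 0"
proof -
  have M: "M \<ge> 0"
    using order_trans[OF norm_ge_zero bound] .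
  have "norm (b 1) \<le> 12 * \<epsilon> * M" if \<epsilon>: "\<epsilon> > 0" for \<epsilon>
  proof -
    obtain C where C: "fact n * norm (b n) \<le> C * \<epsilon> ^ n" for n
      using assms(1) \<epsilon> unfolding minimal_type_def by blast
    have "C \<ge> 0"
      using order_trans[OF _ C[of 0], of 0] by simp
    have "norm (b 1) \<le> 12 * \<epsilon> * (M + C * (1 / 2) ^ N)" if N: "N > 0" for N
    proof -
      define R where "R = real N / (6 * \<epsilon>)"
      have R: "R > 0"
        using N \<epsilon> by (simp add: R_def)
      have term_le: "norm (b n) * R ^ n \<le> C * (1 / 2) ^ n" if "n \<ge> N" for n
      proof -
        have "(\<epsilon> * R) ^ n \<le> (real n / 6) ^ n"
          using that \<epsilon> by (intro power_mono) (auto simp: R_def)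
        also have "\<dots> = real n ^ n * (1 / 6) ^ n"
          by (simp add: power_divide)
        also have "\<dots> \<le> (3 ^ n * fact n) * (1 / 6) ^ n"
          by (intro mult_right_mono power_self_le_fact) simp
        also have "\<dots> = (3 * (1 / 6)) ^ n * fact n"
          by (simp only: power_mult_distrib mult_ac)
        also have "\<dots> = (1 / 2) ^ n * fact n"
          by simp
        finally have "(\<epsilon> * R) ^ n \<le> (1 / 2) ^ n * fact n" .
        then have "C * (\<epsilon> * R) ^ n \<le> C * ((1 / 2) ^ n * fact n)"
          using \<open>C \<ge> 0\<close> by (rule mult_left_mono)
        moreover have "fact n * norm (b n) * R ^ n \<le> C * \<epsilon> ^ n * R ^ n"
          using C R by (intro mult_right_mono) auto
        then have "fact n * (norm (b n) * R ^ n) \<le> C * (\<epsilon> * R) ^ n"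
          by (simp only: power_mult_distrib mult_ac)
        ultimately have "fact n * (norm (b n) * R ^ n) \<le> fact n * (C * (1 / 2) ^ n)"
          by (simp only: mult_ac)
        then show ?thesis
          by (rule mult_left_le_imp_le) simp
      qed
      have geo: "(\<lambda>n. C * (1 / 2) ^ (n + Suc N)) sums (C * (1 / 2) ^ N)"
      proof -
        have "(\<lambda>n. C * (1 / 2) ^ Suc N * (1 / 2) ^ n) sums (C * (1 / 2) ^ Suc N * (1 / (1 - 1 / 2)))"
          by (intro sums_mult geometric_sums) auto
        then show ?thesis
          by (simp add: power_add mult_ac)
      qed
      have "(\<Sum>n. norm (b (n + Suc N)) * R ^ (n + Suc N)) \<le> (\<Sum>n. C * (1 / 2) ^ (n + Suc N))"
      proof (rule suminf_le)
        show "summable (\<lambda>n. norm (b (n + Suc N)) * R ^ (n + Suc N))"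
          using minimal_type_summable_norm[OF assms(1), of R]
          by (subst summable_iff_shift[where f = "\<lambda>n. norm (b n) * R ^ n"])
        show "norm (b (n + Suc N)) * R ^ (n + Suc N) \<le> C * (1 / 2) ^ (n + Suc N)" for n
          by (rule term_le) simp
        show "summable (\<lambda>n. C * (1 / 2) ^ (n + Suc N))"
          using geo by (rule sums_summable)
      qed
      then have "M + (\<Sum>n. norm (b (n + Suc N)) * R ^ (n + Suc N)) \<le> M + C * (1 / 2) ^ N"
        using sums_unique[OF geo] by simp
      then have "2 * real N * (M + (\<Sum>n. norm (b (n + Suc N)) * R ^ (n + Suc N)))
          \<le> 2 * real N * (M + C * (1 / 2) ^ N)"
        by (rule mult_left_mono) simp
      with first_coefficient_bound[OF assms(1) N R bound]
      have "R * norm (b 1) \<le> 2 * real N * (M + C * (1 / 2) ^ N)"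
        by linarith
      also have "\<dots> = R * (12 * \<epsilon> * (M + C * (1 / 2) ^ N))"
        using \<epsilon> by (simp add: R_def)
      finally show ?thesis
        using R by simp
    qed
    then have "eventually (\<lambda>N. norm (b 1) \<le> 12 * \<epsilon> * (M + C * (1 / 2) ^ N)) sequentially"
      by (intro eventually_mono[OF eventually_gt_at_top[of 0]])
    moreover have "(\<lambda>N. 12 * \<epsilon> * (M + C * (1 / 2) ^ N)) \<longlonglongrightarrow> 12 * \<epsilon> * (M + C * 0)"
      by (intro tendsto_intros LIMSEQ_power_zero) auto
    ultimately show ?thesis
      by (auto intro: tendsto_lowerbound)
  qed
  then have "eventually (\<lambda>\<epsilon>. norm (b 1) \<le> 12 * \<epsilon> * M) (at_right 0)"
    by (auto simp: eventually_at_filter)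
  moreover have "((\<lambda>\<epsilon>. 12 * \<epsilon> * M) \<longlongrightarrow> 12 * 0 * M) (at_right 0)"
    by (intro tendsto_intros)
  ultimately have "norm (b 1) \<le> 12 * 0 * M"
    by (intro tendsto_lowerbound[where F = "at_right 0"]) auto
  then show ?thesis
    by simp
qed

lemma shifted_series:
  fixes b :: "nat \<Rightarrow> 'b::banach"
  assumes "minimal_type b"
  shows "t ^ m *\<^sub>R (\<Sum>n. t ^ n *\<^sub>R b (n + m)) = (\<Sum>n. t ^ n *\<^sub>R b n) - (\<Sum>n<m. t ^ n *\<^sub>R b n)"
proof -
  have "(\<lambda>n. t ^ m *\<^sub>R (t ^ n *\<^sub>R b (n + m))) sums (t ^ m *\<^sub>R (\<Sum>n. t ^ n *\<^sub>R b (n + m)))"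
    by (intro sums_scaleR_right minimal_type_sums minimal_type_shift assms)
  then have "(\<lambda>n. t ^ (n + m) *\<^sub>R b (n + m)) sums (t ^ m *\<^sub>R (\<Sum>n. t ^ n *\<^sub>R b (n + m)))"
    by (simp add: power_add mult.commute)
  then show ?thesis
    using suminf_split_initial_segment[OF sums_summable[OF minimal_type_sums[OF assms]], of t m]
      sums_unique by fastforce
qed

lemma bounded_on_unit_interval:
  fixes b :: "nat \<Rightarrow> 'b::banach"
  assumes "minimal_type b" and "\<bar>t\<bar> \<le> 1"
  shows "norm (\<Sum>n. t ^ n *\<^sub>R b n) \<le> (\<Sum>n. norm (b n))"
proof (rule norm_suminf_le)
  show "norm (t ^ n *\<^sub>R b n) \<le> norm (b n)" for n
    using assms(2) by (simp add: power_abs mult_left_le_one_le power_le_one)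
  show "summable (\<lambda>n. norm (b n))"
    using minimal_type_summable_norm[OF assms(1), of 1] by simp
qed

text \<open>
  Dividing the function minus its value at 0 by \<open>t\<close> preserves both boundedness and the type, and it
  moves the next coefficient into first place.
\<close>

lemma bounded_minimal_type_constant:
  fixes b :: "nat \<Rightarrow> 'b::banach"
  assumes "minimal_type b" and bound: "\<And>t. norm (\<Sum>n. t ^ n *\<^sub>R b n) \<le> M"
  shows "b (Suc n) = 0"
  using assms
proof (induction n arbitrary: b M)
  case 0
  then show ?case
    using bounded_minimal_type_first_coefficient by fastforce
next
  case (Suc n)
  let ?b = "\<lambda>n. b (n + 1)"
  have shift: "minimal_type ?b"
    using Suc.prems(1) by (rule minimal_type_shift)
  have "norm (\<Sum>n. t ^ n *\<^sub>R ?b n) \<le> max (\<Sum>n. norm (?b n)) (M + norm (b 0))" for t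
  proof (cases "\<bar>t\<bar> \<le> 1")
    case True
    then show ?thesis
      using bounded_on_unit_interval[OF shift] by (simp add: le_max_iff_disj)
  next
    case False
    have "norm (\<Sum>n. t ^ n *\<^sub>R ?b n) \<le> \<bar>t\<bar> * norm (\<Sum>n. t ^ n *\<^sub>R ?b n)"
      using False by (simp add: mult_le_cancel_right1)
    also have "\<dots> = norm ((\<Sum>n. t ^ n *\<^sub>R b n) - b 0)"
      using arg_cong[OF shifted_series[OF Suc.prems(1), of t 1], of norm] by simp
    also have "\<dots> \<le> M + norm (b 0)"
      using norm_triangle_ineq4 Suc.prems(2) by (meson add_mono order_refl order_trans)
    finally show ?thesis
      by simp
  qed
  from Suc.IH[OF shift this] show ?case
    by simp
qed

text \<open>
  Let \<open>m\<close> be the least integer above \<open>\<alpha>\<close>. Removing the Taylor polynomial of degree below \<open>m\<close> and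
  dividing by \<open>t\<^sup>m\<close> leaves a function \<open>g\<close> that is \<open>O(t\<^sup>\<alpha>\<^sup>-\<^sup>m)\<close> at infinity. It is bounded, hence
  constant, and since it tends to 0 its constant value \<open>a\<^sub>m\<close> vanishes as well.
\<close>

lemma polynomial_growth_imp_polynomial:
  fixes a :: "nat \<Rightarrow> 'b::banach"
  assumes type: "minimal_type a" and "\<alpha> \<ge> 0"
    and growth: "\<And>t. norm (\<Sum>n. t ^ n *\<^sub>R a n) \<le> C * (1 + \<bar>t\<bar>) powr \<alpha>"
    and n: "real n > \<alpha>"
  shows "a n = 0"
proof -
  define m where "m = nat \<lfloor>\<alpha>\<rfloor> + 1"
  have m: "real m > \<alpha>" and below: "\<And>k. k < m \<Longrightarrow> real k \<le> \<alpha>"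
    using assms(2) unfolding m_def by linarith+
  define g where "g = (\<lambda>t. \<Sum>n. t ^ n *\<^sub>R a (n + m))"
  define K where "K = C * 2 powr \<alpha> + (\<Sum>k<m. norm (a k))"
  have shift: "minimal_type (\<lambda>n. a (n + m))"
    using type by (rule minimal_type_shift)
  have "0 \<le> C"
    using order_trans[OF norm_ge_zero growth[of 0]] by simp
  then have K: "K \<ge> 0"
    by (auto simp: K_def intro!: add_nonneg_nonneg sum_nonneg)
  have decay: "norm (g t) \<le> K * \<bar>t\<bar> powr (\<alpha> - real m)" if t: "\<bar>t\<bar> \<ge> 1" for t
  proof -
    have "C * (1 + \<bar>t\<bar>) powr \<alpha> \<le> C * (2 * \<bar>t\<bar>) powr \<alpha>"
      using t \<open>0 \<le> C\<close> assms(2) by (intro mult_left_mono powr_mono2) auto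
    then have f_le: "norm (\<Sum>n. t ^ n *\<^sub>R a n) \<le> C * 2 powr \<alpha> * \<bar>t\<bar> powr \<alpha>"
      using growth[of t] by (simp add: powr_mult)
    have "norm (t ^ k *\<^sub>R a k) \<le> norm (a k) * \<bar>t\<bar> powr \<alpha>" if "k < m" for k
    proof -
      have "\<bar>t\<bar> ^ k \<le> \<bar>t\<bar> powr \<alpha>"
        using t below[OF that] by (subst powr_realpow[symmetric]) (auto intro!: powr_mono)
      then show ?thesis
        by (simp add: power_abs mult.commute mult_left_mono)
    qed
    then have p_le: "norm (\<Sum>k<m. t ^ k *\<^sub>R a k) \<le> (\<Sum>k<m. norm (a k)) * \<bar>t\<bar> powr \<alpha>"
      unfolding sum_distrib_right by (intro sum_norm_le) auto
    have "\<bar>t\<bar> ^ m * norm (g t) = norm ((\<Sum>n. t ^ n *\<^sub>R a n) - (\<Sum>k<m. t ^ k *\<^sub>R a k))"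
      using arg_cong[OF shifted_series[OF type, of t m], of norm]
      by (simp add: g_def power_abs)
    also have "\<dots> \<le> K * \<bar>t\<bar> powr \<alpha>"
      using norm_triangle_ineq4[of "\<Sum>n. t ^ n *\<^sub>R a n" "\<Sum>k<m. t ^ k *\<^sub>R a k"] f_le p_le
      by (simp add: K_def distrib_right)
    also have "K * \<bar>t\<bar> powr \<alpha> = \<bar>t\<bar> ^ m * (K * \<bar>t\<bar> powr (\<alpha> - real m))"
      using t by (simp add: powr_diff powr_realpow)
    finally show ?thesis
      using t by (simp add: mult_le_cancel_left)
  qed
  have "norm (g t) \<le> max (\<Sum>n. norm (a (n + m))) K" for t
  proof (cases "\<bar>t\<bar> \<le> 1")
    case True
    then show ?thesis
      using bounded_on_unit_interval[OF shift] by (simp add: g_def le_max_iff_disj)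
  next
    case False
    then have "\<bar>t\<bar> powr (\<alpha> - real m) \<le> \<bar>t\<bar> powr 0"
      using m by (intro powr_mono) auto
    moreover have "\<bar>t\<bar> powr 0 = 1"
      using False by (subst powr_zero_eq_one) auto
    ultimately have "K * \<bar>t\<bar> powr (\<alpha> - real m) \<le> K"
      using K by (intro mult_left_le) auto
    then show ?thesis
      using decay[of t] False by simp
  qed
  then have higher: "a (Suc k + m) = 0" for k
    unfolding g_def using bounded_minimal_type_constant[OF shift] by blast
  have "a m = 0"
  proof -
    have "g t = (\<Sum>n\<in>{0}. t ^ n *\<^sub>R a (n + m))" for t
      unfolding g_def
    proof (rule suminf_finite)
      show "t ^ n *\<^sub>R a (n + m) = 0" if "n \<notin> {0}" for n
        using that higher[of "n - 1"] by (cases n) auto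
    qed simp
    then have "g t = a m" for t
      by simp
    then have "norm (a m) \<le> K * t powr (\<alpha> - real m)" if "t \<ge> 1" for t
      using decay[of t] that by simp
    then have "eventually (\<lambda>t. norm (a m) \<le> K * t powr (\<alpha> - real m)) at_top"
      by (intro eventually_mono[OF eventually_ge_at_top[of 1]])
    moreover have "((\<lambda>t. K * t powr (\<alpha> - real m)) \<longlongrightarrow> K * 0) at_top"
      using m by (intro tendsto_intros tendsto_neg_powr filterlim_ident) auto
    ultimately have "norm (a m) \<le> K * 0"
      by (intro tendsto_lowerbound[where F = at_top]) auto
    then show ?thesis
      by simp
  qed
  moreover have "n \<ge> m"
    using n assms(2) unfolding m_def by linarith
  ultimately show ?thesis
    using higher[of "n - m - 1"] by (cases "n = m") auto
qed

section \<open>Conjugation by exponentials and the inner derivation\<close>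

text \<open>
  The double family \<open>prod (a i) (b j)\<close> is absolutely summable, so it may be summed by rows, which
  gives the product of the sums, or along the diagonals \<open>i + j = n\<close>. The form for bilinear maps
  covers products \<open>X T Y\<close> of operators with a fixed factor in the middle.
\<close>

lemma Cauchy_product_bounded_bilinear:
  fixes prod :: "'a::banach \<Rightarrow> 'b::banach \<Rightarrow> 'c::banach"
  assumes "bounded_bilinear prod"
    and a: "summable (\<lambda>n. norm (a n))" and b: "summable (\<lambda>n. norm (b n))"
  shows "(\<lambda>n. \<Sum>i\<le>n. prod (a i) (b (n - i))) sums prod (\<Sum>n. a n) (\<Sum>n. b n)"
proof -
  interpret bounded_bilinear prod by fact
  obtain K where K: "norm (prod x y) \<le> norm x * norm y * K" and "K \<ge> 0" for x y
    using nonneg_bounded by blast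
  let ?f = "\<lambda>(i, j). prod (a i) (b j)"
  have has_sum_a: "(a has_sum (\<Sum>n. a n)) UNIV"
    and has_sum_b: "(b has_sum (\<Sum>n. b n)) UNIV"
    and has_sum_norm_a: "((\<lambda>n. norm (a n)) has_sum (\<Sum>n. norm (a n))) UNIV"
    and has_sum_norm_b: "((\<lambda>n. norm (b n)) has_sum (\<Sum>n. norm (b n))) UNIV"
    using a b by (auto intro!: norm_summable_imp_has_sum summable_sums summable_norm_cancel[of a]
        summable_norm_cancel[of b])
  have "(\<lambda>(i, j). norm (a i) * norm (b j) * K) summable_on (SIGMA i:UNIV. UNIV)"
  proof (rule summable_on_SigmaI)
    show "((\<lambda>j. case (i, j) of (i, j) \<Rightarrow> norm (a i) * norm (b j) * K)
        has_sum (norm (a i) * (\<Sum>n. norm (b n)) * K)) UNIV" for i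
      using has_sum_norm_b by (simp add: has_sum_cmult_left has_sum_cmult_right)
    show "(\<lambda>i. norm (a i) * (\<Sum>n. norm (b n)) * K) summable_on UNIV"
      using has_sum_norm_a by (intro summable_on_cmult_left) (auto simp: summable_on_def)
  qed (use \<open>K \<ge> 0\<close> in auto)
  then have "(\<lambda>p. norm (?f p)) summable_on (SIGMA i:UNIV. UNIV)"
    by (rule Infinite_Sum.abs_summable_on_comparison_test') (use K in auto)
  then have "?f summable_on (SIGMA i:UNIV. UNIV)"
    by (rule abs_summable_summable)
  then obtain S where S: "(?f has_sum S) (SIGMA i:UNIV. UNIV)"
    by (auto simp: summable_on_def)
  have row: "((\<lambda>j. ?f (i, j)) has_sum prod (a i) (\<Sum>n. b n)) UNIV" for i
    using has_sum_bounded_linear[OF bounded_linear_right has_sum_b] by simp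
  have "((\<lambda>i. prod (a i) (\<Sum>n. b n)) has_sum S) UNIV"
    by (rule has_sum_SigmaD[OF S row])
  moreover have "((\<lambda>i. prod (a i) (\<Sum>n. b n)) has_sum prod (\<Sum>n. a n) (\<Sum>n. b n)) UNIV"
    by (rule has_sum_bounded_linear[OF bounded_linear_left has_sum_a])
  ultimately have S_eq: "S = prod (\<Sum>n. a n) (\<Sum>n. b n)"
    by (rule has_sum_unique)
  have bij: "bij_betw (\<lambda>(n, i). (i, n - i)) (SIGMA n:UNIV. {..n}) (SIGMA i:(UNIV :: nat set). (UNIV :: nat set))"
    by (rule bij_betw_byWitness[where f' = "\<lambda>(i, j). (i + j, i)"]) auto
  have "((\<lambda>p. ?f ((\<lambda>(n, i). (i, n - i)) p)) has_sum S) (SIGMA n:UNIV. {..n})"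
    using S by (subst has_sum_reindex_bij_betw[OF bij])
  then have "((\<lambda>n. \<Sum>i\<le>n. prod (a i) (b (n - i))) has_sum S) UNIV"
  proof (rule has_sum_SigmaD)
    show "((\<lambda>i. ?f ((\<lambda>(n, i). (i, n - i)) (n, i))) has_sum (\<Sum>i\<le>n. prod (a i) (b (n - i)))) {..n}" for n
      by (simp add: has_sum_finite)
  qed
  then show ?thesis
    unfolding S_eq by (rule has_sum_imp_sums)
qed

interpretation compose: bounded_bilinear "(o\<^sub>L)"
  by (rule bounded_bilinear_blinfun_compose)

lemma compose_assoc: "(A o\<^sub>L B) o\<^sub>L C = A o\<^sub>L (B o\<^sub>L C)"
  by (rule blinfun_eqI) simp

lemma compose_id [simp]: "id_blinfun o\<^sub>L A = A" "A o\<^sub>L id_blinfun = A"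
  by (rule blinfun_eqI; simp)+

lemma op_power_0 [simp]: "op_power A 0 = id_blinfun"
  by (simp add: op_power_def)

lemma op_power_Suc: "op_power A (Suc n) = A o\<^sub>L op_power A n"
  by (simp add: op_power_def)

lemma op_power_Suc_right: "op_power A (Suc n) = op_power A n o\<^sub>L A"
  by (induction n) (simp_all add: op_power_Suc compose_assoc[symmetric])

lemma op_power_scaleR: "op_power (t *\<^sub>R A) n = t ^ n *\<^sub>R op_power A n"
  by (induction n) (simp_all add: op_power_Suc compose.scaleR_left compose.scaleR_right)

definition exp_term :: "('a::banach \<Rightarrow>\<^sub>L 'a) \<Rightarrow> nat \<Rightarrow> 'a \<Rightarrow>\<^sub>L 'a"
  where "exp_term A n = op_power A n /\<^sub>R fact n"

lemma compose_exp_term: "A o\<^sub>L exp_term A n = real (Suc n) *\<^sub>R exp_term A (Suc n)"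
  by (simp add: exp_term_def op_power_Suc compose.scaleR_right del: of_nat_Suc)

lemma exp_term_compose: "exp_term A n o\<^sub>L A = real (Suc n) *\<^sub>R exp_term A (Suc n)"
  by (simp add: exp_term_def op_power_Suc_right compose.scaleR_left del: of_nat_Suc)

lemma exp_term_scaleR: "exp_term (t *\<^sub>R A) n = t ^ n *\<^sub>R exp_term A n"
  by (simp add: exp_term_def op_power_scaleR)

lemma summable_norm_exp_term: "summable (\<lambda>n. norm (exp_term A n))"
proof (rule summable_comparison_test')
  show "summable (\<lambda>n. norm A ^ n /\<^sub>R fact n)"
    by (rule summable_exp_generic)
  show "norm (norm (exp_term A n)) \<le> norm A ^ n /\<^sub>R fact n" for n
    using norm_op_power_le[of A n] by (simp add: exp_term_def field_simps)
qed

text \<open>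
  This is the binomial formula for left minus right multiplication, with the factorials distributed
  over the exponential terms. In that form the induction step is the Leibniz rule: multiplying by
  \<open>A\<close> on the left weights the \<open>i\<close>-th term of the next sum by \<open>i\<close>, multiplying by \<open>-A\<close> on the right
  by \<open>n + 1 - i\<close>.
\<close>

lemma inner_derivation_power_expansion:
  fixes A T :: "'a::complex_banach \<Rightarrow>\<^sub>L 'a"
  shows "(inner_derivation A ^^ n) T
    = fact n *\<^sub>R (\<Sum>i\<le>n. exp_term A i o\<^sub>L (T o\<^sub>L exp_term (- A) (n - i)))"
proof (induction n)
  case 0
  then show ?case
    by (simp add: exp_term_def)
next
  case (Suc n)
  let ?P = "\<lambda>i. exp_term A i o\<^sub>L (T o\<^sub>L exp_term (- A) (Suc n - i))"
  let ?S = "\<Sum>i\<le>n. exp_term A i o\<^sub>L (T o\<^sub>L exp_term (- A) (n - i))"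
  have "A o\<^sub>L ?S = (\<Sum>i\<le>n. real (Suc i) *\<^sub>R ?P (Suc i))"
    by (simp add: compose.sum_right compose_assoc[symmetric] compose_exp_term compose.scaleR_left
        del: of_nat_Suc)
  also have "\<dots> = (\<Sum>i\<le>Suc n. real i *\<^sub>R ?P i)"
    by (simp only: sum.atMost_Suc_shift) simp
  finally have left: "A o\<^sub>L ?S = (\<Sum>i\<le>Suc n. real i *\<^sub>R ?P i)" .
  have "?S o\<^sub>L (- A) = (\<Sum>i\<le>n. real (Suc n - i) *\<^sub>R ?P i)"
    by (simp add: compose.sum_left compose_assoc exp_term_compose compose.scaleR_right Suc_diff_le
        del: of_nat_Suc)
  then have right: "?S o\<^sub>L (- A) = (\<Sum>i\<le>Suc n. real (Suc n - i) *\<^sub>R ?P i)"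
    by simp
  have "inner_derivation A ?S = (A o\<^sub>L ?S) + (?S o\<^sub>L (- A))"
    by (simp add: inner_derivation_def compose.minus_right)
  also have "\<dots> = (\<Sum>i\<le>Suc n. real (Suc n) *\<^sub>R ?P i)"
    unfolding left right sum.distrib[symmetric] scaleR_add_left[symmetric]
    by (intro sum.cong) (auto simp: of_nat_diff)
  also have "\<dots> = real (Suc n) *\<^sub>R (\<Sum>i\<le>Suc n. ?P i)"
    by (simp only: scaleR_sum_right)
  finally have "inner_derivation A ?S = real (Suc n) *\<^sub>R (\<Sum>i\<le>Suc n. ?P i)" .
  moreover have "inner_derivation A (fact n *\<^sub>R ?S) = fact n *\<^sub>R inner_derivation A ?S"
    by (simp add: inner_derivation_def compose.scaleR_left compose.scaleR_right scaleR_diff_right)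
  ultimately show ?case
    using Suc.IH by (simp add: mult.commute del: sum.atMost_Suc of_nat_Suc)
qed

lemma conjugation_by_exp_sums:
  fixes A T :: "'a::complex_banach \<Rightarrow>\<^sub>L 'a"
  shows "(\<lambda>n. t ^ n *\<^sub>R ((inner_derivation A ^^ n) T /\<^sub>R fact n))
    sums (op_exp (t *\<^sub>R A) o\<^sub>L T o\<^sub>L op_exp (- (t *\<^sub>R A)))"
proof -
  have "bounded_bilinear (\<lambda>X Y. X o\<^sub>L (T o\<^sub>L Y))"
    by (rule compose.comp[OF bounded_linear_ident compose.bounded_linear_right])
  then have "(\<lambda>n. \<Sum>i\<le>n. exp_term (t *\<^sub>R A) i o\<^sub>L (T o\<^sub>L exp_term (t *\<^sub>R - A) (n - i)))
      sums (op_exp (t *\<^sub>R A) o\<^sub>L (T o\<^sub>L op_exp (t *\<^sub>R - A)))"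
    unfolding op_exp_def exp_term_def[symmetric]
    by (rule Cauchy_product_bounded_bilinear) (rule summable_norm_exp_term)+
  moreover have "(\<Sum>i\<le>n. exp_term (t *\<^sub>R A) i o\<^sub>L (T o\<^sub>L exp_term (t *\<^sub>R - A) (n - i)))
      = t ^ n *\<^sub>R ((inner_derivation A ^^ n) T /\<^sub>R fact n)" for n
  proof -
    have "exp_term (t *\<^sub>R A) i o\<^sub>L (T o\<^sub>L exp_term (t *\<^sub>R - A) (n - i))
        = t ^ n *\<^sub>R (exp_term A i o\<^sub>L (T o\<^sub>L exp_term (- A) (n - i)))" if "i \<le> n" for i
      unfolding exp_term_scaleR using that
      by (simp add: compose.scaleR_left compose.scaleR_right flip: power_add)
    then show ?thesis
      by (simp add: inner_derivation_power_expansion scaleR_sum_right)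
  qed
  ultimately show ?thesis
    by (simp add: compose_assoc)
qed

lemma norm_inner_derivation_power_le:
  fixes A T :: "'a::complex_banach \<Rightarrow>\<^sub>L 'a"
  assumes C: "\<And>n. norm (op_power A n) \<le> C * \<epsilon> ^ n"
  shows "norm ((inner_derivation A ^^ n) T) \<le> (C\<^sup>2 * norm T) * (2 * \<epsilon>) ^ n"
proof -
  have plus: "norm (exp_term A i) \<le> C * \<epsilon> ^ i / fact i" for i
    using C[of i] by (simp add: exp_term_def divide_simps)
  moreover have "norm (exp_term (- A) i) = norm (exp_term A i)" for i
    using exp_term_scaleR[of "- 1" A i] by (simp add: power_abs)
  ultimately have minus: "norm (exp_term (- A) i) \<le> C * \<epsilon> ^ i / fact i" for i
    by simp
  have "norm (exp_term A i o\<^sub>L (T o\<^sub>L exp_term (- A) (n - i)))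
      \<le> C\<^sup>2 * norm T * \<epsilon> ^ n * (real (n choose i) / fact n)" if "i \<le> n" for i
  proof -
    have "norm (exp_term A i o\<^sub>L (T o\<^sub>L exp_term (- A) (n - i)))
        \<le> norm (exp_term A i) * (norm T * norm (exp_term (- A) (n - i)))"
      by (intro order_trans[OF norm_blinfun_compose] mult_left_mono norm_blinfun_compose) simp
    also have "\<dots> \<le> (C * \<epsilon> ^ i / fact i) * (norm T * (C * \<epsilon> ^ (n - i) / fact (n - i)))"
      by (intro mult_mono plus minus mult_left_mono mult_nonneg_nonneg norm_ge_zero
          order_trans[OF norm_ge_zero plus])
    also have "\<dots> = C\<^sup>2 * norm T * (\<epsilon> ^ i * \<epsilon> ^ (n - i)) * (1 / (fact i * fact (n - i)))"
      by (simp add: power2_eq_square)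
    also have "\<epsilon> ^ i * \<epsilon> ^ (n - i) = \<epsilon> ^ n"
      using that by (simp flip: power_add)
    also have "1 / (fact i * fact (n - i)) = real (n choose i) / fact n"
      using that by (simp add: binomial_fact)
    finally show ?thesis .
  qed
  then have "norm (\<Sum>i\<le>n. exp_term A i o\<^sub>L (T o\<^sub>L exp_term (- A) (n - i)))
      \<le> (\<Sum>i\<le>n. C\<^sup>2 * norm T * \<epsilon> ^ n * (real (n choose i) / fact n))"
    by (intro sum_norm_le) auto
  also have "\<dots> = C\<^sup>2 * norm T * \<epsilon> ^ n * (real (\<Sum>i\<le>n. n choose i) / fact n)"
    by (simp only: of_nat_sum sum_divide_distrib sum_distrib_left)
  also have "\<dots> = C\<^sup>2 * norm T * (2 * \<epsilon>) ^ n / fact n"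
    by (simp add: choose_row_sum power_mult_distrib)
  finally have "fact n * norm (\<Sum>i\<le>n. exp_term A i o\<^sub>L (T o\<^sub>L exp_term (- A) (n - i)))
      \<le> fact n * (C\<^sup>2 * norm T * (2 * \<epsilon>) ^ n / fact n)"
    by (intro mult_left_mono) auto
  then show ?thesis
    unfolding inner_derivation_power_expansion by simp
qed

section \<open>Operators whose spectrum is a single point\<close>

lemma bops_scalar_op [simp]: "scalar_op c \<in> bops"
  by (simp add: bops_def scalar_op.rep_eq scaleC_scaleC mult.commute)

lemma bops_diff: "S \<in> bops \<Longrightarrow> T \<in> bops \<Longrightarrow> S - T \<in> bops"
proof -
  have "c *\<^sub>C (x - y) = c *\<^sub>C x - c *\<^sub>C y" for c and x y :: 'a
    using scaleC_add_right[of c "x - y" y] by (simp add: algebra_simps)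
  then show "S \<in> bops \<Longrightarrow> T \<in> bops \<Longrightarrow> S - T \<in> bops" for S T :: "'a \<Rightarrow>\<^sub>L 'a"
    by (simp add: bops_def blinfun.diff_left)
qed

lemma bops_compose: "S \<in> bops \<Longrightarrow> T \<in> bops \<Longrightarrow> S o\<^sub>L T \<in> bops"
  by (simp add: bops_def)

lemma scalar_op_commute: "T \<in> bops \<Longrightarrow> T o\<^sub>L scalar_op c = scalar_op c o\<^sub>L T"
  by (rule blinfun_eqI) (simp add: bops_def scalar_op.rep_eq)

lemma scalar_op_mult: "scalar_op (c * d) = scalar_op c o\<^sub>L scalar_op d"
  by (rule blinfun_eqI) (simp add: scalar_op.rep_eq scaleC_scaleC)

lemma scalar_op_add: "scalar_op (c + d) = scalar_op c + scalar_op d"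
  by (rule blinfun_eqI) (simp add: scalar_op.rep_eq scaleC_add_left blinfun.add_left)

lemma scalar_op_of_real: "scalar_op (of_real r) = r *\<^sub>R id_blinfun"
  by (rule blinfun_eqI) (simp add: scalar_op.rep_eq scaleC_of_real blinfun.scaleR_left)

lemma scalar_op_0 [simp]: "scalar_op 0 = 0"
  using scalar_op_of_real[of 0] by simp

lemma scalar_op_1 [simp]: "scalar_op 1 = id_blinfun"
  using scalar_op_of_real[of 1] by simp

lemma scalar_op_diff: "scalar_op (c - d) = scalar_op c - scalar_op d"
  by (simp add: eq_diff_eq flip: scalar_op_add)

lemma scalar_op_sum: "scalar_op (sum f I) = (\<Sum>i\<in>I. scalar_op (f i))"
  by (induction I rule: infinite_finite_induct) (simp_all add: scalar_op_add)

lemma norm_scalar_op_compose_le: "norm (scalar_op c o\<^sub>L T) \<le> cmod c * norm T"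
proof (rule norm_blinfun_bound)
  show "norm ((scalar_op c o\<^sub>L T) x) \<le> cmod c * norm T * norm x" for x
    by (simp add: scalar_op.rep_eq norm_scaleC mult.assoc mult_left_mono norm_blinfun)
qed simp

lemma op_power_scalar_op_compose:
  assumes "Q \<in> bops"
  shows "op_power (scalar_op c o\<^sub>L Q) n = scalar_op (c ^ n) o\<^sub>L op_power Q n"
proof (induction n)
  case (Suc n)
  have "op_power (scalar_op c o\<^sub>L Q) (Suc n) = scalar_op c o\<^sub>L ((Q o\<^sub>L scalar_op (c ^ n)) o\<^sub>L op_power Q n)"
    by (simp add: op_power_Suc Suc compose_assoc)
  also have "\<dots> = scalar_op (c ^ Suc n) o\<^sub>L op_power Q (Suc n)"
    unfolding scalar_op_commute[OF assms] by (simp add: op_power_Suc scalar_op_mult compose_assoc)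
  finally show ?case .
qed simp

lemma id_minus_op_power:
  "id_blinfun - op_power X n = (id_blinfun - X) o\<^sub>L (\<Sum>j<n. op_power X j)"
proof (induction n)
  case (Suc n)
  have "(id_blinfun - X) o\<^sub>L (\<Sum>j<Suc n. op_power X j)
      = (id_blinfun - op_power X n) + ((id_blinfun - X) o\<^sub>L op_power X n)"
    by (simp add: compose.add_right Suc)
  also have "(id_blinfun - X) o\<^sub>L op_power X n = op_power X n - op_power X (Suc n)"
    by (simp add: compose.diff_left op_power_Suc)
  finally show ?case
    by simp
qed simp

lemma norm_mean_le:
  fixes f :: "nat \<Rightarrow> 'b::real_normed_vector"
  assumes "n > 0" and "\<And>k. norm (f k) \<le> B"
  shows "norm ((\<Sum>k<n. f k) /\<^sub>R real n) \<le> B"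
proof -
  have "norm (\<Sum>k<n. f k) \<le> real n * B"
    using assms(2) sum_norm_bound[of "{..<n}" f B] by simp
  then show ?thesis
    using assms(1) by (simp add: field_simps)
qed

text \<open>
  The locale describes an operator for which \<open>1 - w Q\<close> is invertible at every complex \<open>w\<close>, with
  inverse \<open>J w\<close>. In the variable \<open>w = 1 / \<lambda>\<close> this is invertibility of \<open>\<lambda> - Q\<close> for all \<open>\<lambda> \<noteq> 0\<close>;
  unlike the resolvent itself, \<open>J\<close> has no singularity, so it is bounded on every disc.
\<close>

locale entire_resolvent =
  fixes Q :: "'a::complex_banach \<Rightarrow>\<^sub>L 'a" and J :: "complex \<Rightarrow> 'a \<Rightarrow>\<^sub>L 'a"
  assumes Q: "Q \<in> bops"
    and left_inverse: "J w o\<^sub>L (id_blinfun - (scalar_op w o\<^sub>L Q)) = id_blinfun"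
    and right_inverse: "(id_blinfun - (scalar_op w o\<^sub>L Q)) o\<^sub>L J w = id_blinfun"
begin

lemma resolvent_identity: "J w - J v = J w o\<^sub>L ((scalar_op (w - v) o\<^sub>L Q) o\<^sub>L J v)"
proof -
  let ?W = "id_blinfun - (scalar_op w o\<^sub>L Q)" and ?V = "id_blinfun - (scalar_op v o\<^sub>L Q)"
  have "scalar_op (w - v) o\<^sub>L Q = ?V - ?W"
    by (simp add: scalar_op_diff compose.diff_left)
  then have "J w o\<^sub>L ((scalar_op (w - v) o\<^sub>L Q) o\<^sub>L J v) = (J w o\<^sub>L (?V o\<^sub>L J v)) - ((J w o\<^sub>L ?W) o\<^sub>L J v)"
    by (simp only: compose.diff_left compose.diff_right compose_assoc)
  then show ?thesis
    by (simp only: left_inverse right_inverse compose_id)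
qed

lemma norm_resolvent_diff_le: "norm (J w - J v) \<le> norm (J w) * (cmod (w - v) * norm Q * norm (J v))"
  unfolding resolvent_identity
  by (intro order_trans[OF norm_blinfun_compose] mult_left_mono mult_right_mono
      norm_scalar_op_compose_le norm_ge_zero)

text \<open>
  Near \<open>v\<close> the resolvent identity gives \<open>\<parallel>J w - J v\<parallel> \<le> \<parallel>J w\<parallel> / 2\<close>, whence \<open>\<parallel>J w\<parallel> \<le> 2 \<parallel>J v\<parallel>\<close>.
  Inserting this bound into the identity again gives continuity. Existence of all the inverses is
  known beforehand, which replaces the usual appeal to a Neumann series.
\<close>

lemma continuous_resolvent: "continuous_on UNIV J"
proof -
  have "(J \<longlongrightarrow> J v) (at v)" for v
  proof -
    have small: "((\<lambda>w. cmod (w - v) * norm Q * norm (J v)) \<longlongrightarrow> cmod (v - v) * norm Q * norm (J v)) (at v)"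
      by (intro tendsto_intros)
    then have "eventually (\<lambda>w. cmod (w - v) * norm Q * norm (J v) < 1 / 2) (at v)"
      by (rule order_tendstoD) simp
    then have "eventually (\<lambda>w. norm (J w - J v) \<le> 2 * norm (J v) * (cmod (w - v) * norm Q * norm (J v))) (at v)"
    proof eventually_elim
      case (elim w)
      have "norm (J w) * (cmod (w - v) * norm Q * norm (J v)) \<le> norm (J w) * (1 / 2)"
        using elim by (intro mult_left_mono) auto
      then have "norm (J w - J v) \<le> norm (J w) / 2"
        using norm_resolvent_diff_le[of w v] by simp
      then have "norm (J w) \<le> 2 * norm (J v)"
        using norm_triangle_ineq2[of "J w" "J v"] by simp
      then have "norm (J w) * (cmod (w - v) * norm Q * norm (J v))
          \<le> 2 * norm (J v) * (cmod (w - v) * norm Q * norm (J v))"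
        by (rule mult_right_mono) simp
      then show ?case
        using norm_resolvent_diff_le[of w v] by linarith
    qed
    moreover have "((\<lambda>w. 2 * norm (J v) * (cmod (w - v) * norm Q * norm (J v))) \<longlongrightarrow> 0) (at v)"
      using tendsto_mult_left[OF small, of "2 * norm (J v)"] by simp
    ultimately have "((\<lambda>w. J w - J v) \<longlongrightarrow> 0) (at v)"
      by (rule Lim_null_comparison)
    then show ?thesis
      by (simp add: LIM_zero_iff)
  qed
  then show ?thesis
    by (simp add: continuous_on_def)
qed

lemma resolvent_bounded_on_disc: "\<exists>M>0. \<forall>w. cmod w \<le> R \<longrightarrow> norm (J w) \<le> M"
proof -
  have "compact (J ` cball 0 R)"
    by (intro compact_continuous_image continuous_on_subset[OF continuous_resolvent] compact_cball) auto
  then have "bounded (J ` cball 0 R)"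
    by (rule compact_imp_bounded)
  then show ?thesis
    by (auto simp: bounded_pos)
qed

definition circle_mean :: "nat \<Rightarrow> real \<Rightarrow> 'a \<Rightarrow>\<^sub>L 'a"
  where "circle_mean n r = (\<Sum>k<n. J (of_real r * cis (2 * pi * real k / real n))) /\<^sub>R real n"

text \<open>
  For \<open>w = r \<omega>\<close> with \<open>\<omega>\<^sup>n = 1\<close>, the factorization \<open>1 - r\<^sup>n Q\<^sup>n = (1 - w Q) (\<Sum>j<n. w\<^sup>j Q\<^sup>j)\<close> shows that
  \<open>J w (1 - r\<^sup>n Q\<^sup>n)\<close> is the geometric sum. Averaging over \<open>\<omega>\<close> removes all powers except
  \<open>j = 0\<close>.
\<close>

lemma circle_mean_inverse:
  assumes "n > 0"
  shows "circle_mean n r o\<^sub>L (id_blinfun - r ^ n *\<^sub>R op_power Q n) = id_blinfun"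
proof -
  define w where "w = (\<lambda>k. complex_of_real r * cis (2 * pi * real k / real n))"
  have w_pow: "w k ^ j = of_real (r ^ j) * cis (of_int (int j) * (2 * pi * real k / real n))" for k j
    by (simp add: w_def power_mult_distrib Complex.DeMoivre)
  have w_pow_n: "w k ^ n = of_real (r ^ n)" for k
  proof -
    have "cis (of_int (int n) * (2 * pi * real k / real n)) = cis (2 * pi * of_int (int k))"
      using assms by simp
    also have "\<dots> = 1"
      by (rule cis_multiple_2pi) simp
    finally show ?thesis
      by (simp only: w_pow) simp
  qed
  have each: "J (w k) o\<^sub>L (id_blinfun - r ^ n *\<^sub>R op_power Q n) = (\<Sum>j<n. scalar_op (w k ^ j) o\<^sub>L op_power Q j)" for k
  proof -
    let ?X = "scalar_op (w k) o\<^sub>L Q"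
    have "id_blinfun - r ^ n *\<^sub>R op_power Q n = id_blinfun - op_power ?X n"
      unfolding op_power_scalar_op_compose[OF Q] w_pow_n scalar_op_of_real
      by (simp add: compose.scaleR_left)
    then have "J (w k) o\<^sub>L (id_blinfun - r ^ n *\<^sub>R op_power Q n) = (J (w k) o\<^sub>L (id_blinfun - ?X)) o\<^sub>L (\<Sum>j<n. op_power ?X j)"
      by (simp only: id_minus_op_power[of ?X] compose_assoc)
    also have "\<dots> = (\<Sum>j<n. scalar_op (w k ^ j) o\<^sub>L op_power Q j)"
      unfolding left_inverse op_power_scalar_op_compose[OF Q] by simp
    finally show ?thesis .
  qed
  have roots: "(\<Sum>k<n. w k ^ j) = (if j = 0 then of_nat n else 0)" if "j < n" for j
    using sum_cis_roots_of_unity[OF assms, of "int j"] that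
    by (auto simp: w_pow simp flip: sum_distrib_left dest: dvd_imp_le)
  have "(\<Sum>k<n. J (w k)) o\<^sub>L (id_blinfun - r ^ n *\<^sub>R op_power Q n)
      = (\<Sum>k<n. \<Sum>j<n. scalar_op (w k ^ j) o\<^sub>L op_power Q j)"
    by (simp only: compose.sum_left each)
  also have "\<dots> = (\<Sum>j<n. scalar_op (\<Sum>k<n. w k ^ j) o\<^sub>L op_power Q j)"
    by (subst sum.swap) (simp only: scalar_op_sum compose.sum_left)
  also have "\<dots> = (\<Sum>j<n. if j = 0 then scalar_op (of_real (real n)) else 0)"
    by (intro sum.cong) (auto simp: roots)
  also have "\<dots> = real n *\<^sub>R id_blinfun"
    using assms by (simp add: scalar_op_of_real del: of_real_of_nat_eq)
  finally show ?thesis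
    using assms by (simp add: circle_mean_def w_def compose.scaleR_left)
qed

text \<open>
  Write \<open>F\<^sub>n r\<close> for the mean and \<open>X\<^sub>n r = r\<^sup>n Q\<^sup>n\<close>, so that \<open>F\<^sub>n r - 1 = F\<^sub>n r X\<^sub>n r\<close>. If \<open>X\<^sub>n s\<close> tends to 0
  then \<open>F\<^sub>n s\<close> tends to 1. The resolvent, and with it every mean, is Lipschitz on the disc with
  constant \<open>M\<^sup>2 \<parallel>Q\<parallel>\<close>, so \<open>F\<^sub>n r\<close> stays within distance 1/2 of 1 for \<open>r\<close> close to \<open>s\<close>, and then
  \<open>X\<^sub>n r\<close> is bounded by 1. The distance allowed between \<open>s\<close> and \<open>r\<close> depends only on the disc.
\<close>

lemma power_radius_step:
  assumes disc: "\<And>w. cmod w \<le> R \<Longrightarrow> norm (J w) \<le> M"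
    and s: "0 \<le> s" and r: "s \<le> r" "r \<le> R" and close: "M\<^sup>2 * norm Q * (r - s) \<le> 1 / 4"
    and lim: "(\<lambda>n. s ^ n * norm (op_power Q n)) \<longlonglongrightarrow> 0"
  shows "eventually (\<lambda>n. r ^ n * norm (op_power Q n) \<le> 1) sequentially"
proof -
  have M: "0 \<le> M"
    using order_trans[OF norm_ge_zero disc[of 0]] s r by simp
  have "(\<lambda>n. M * (s ^ n * norm (op_power Q n))) \<longlonglongrightarrow> M * 0"
    by (intro tendsto_intros lim)
  then have "eventually (\<lambda>n. M * (s ^ n * norm (op_power Q n)) < 1 / 4) sequentially"
    by (rule order_tendstoD) simp
  then show ?thesis
    using eventually_gt_at_top[of 0]
  proof eventually_elim
    case (elim n)
    define X where "X = (\<lambda>r. r ^ n *\<^sub>R op_power Q n)"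
    have defect: "circle_mean n r - id_blinfun = circle_mean n r o\<^sub>L X r" for r
      using circle_mean_inverse[OF elim(2), of r] by (simp add: X_def compose.diff_right algebra_simps)
    have "norm (circle_mean n s) \<le> M"
      unfolding circle_mean_def using elim(2) s r
      by (intro norm_mean_le disc) (auto simp: norm_mult)
    then have "norm (circle_mean n s - id_blinfun) \<le> M * (s ^ n * norm (op_power Q n))"
      unfolding defect using s
      by (intro order_trans[OF norm_blinfun_compose] mult_mono) (auto simp: X_def M)
    with elim(1) have at_s: "norm (circle_mean n s - id_blinfun) \<le> 1 / 4"
      by linarith
    have "norm (circle_mean n r - circle_mean n s) \<le> 1 / 4"
    proof -
      let ?u = "\<lambda>k. cis (2 * pi * real k / real n)"
      have "norm (J (of_real r * ?u k) - J (of_real s * ?u k)) \<le> 1 / 4" for k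
      proof -
        have dist: "cmod (of_real r * ?u k - of_real s * ?u k) = r - s"
          using r by (simp add: norm_mult flip: left_diff_distrib of_real_diff)
        have "norm (J (of_real r * ?u k) - J (of_real s * ?u k))
            \<le> norm (J (of_real r * ?u k)) * ((r - s) * norm Q * norm (J (of_real s * ?u k)))"
          using norm_resolvent_diff_le[of "of_real r * ?u k" "of_real s * ?u k"] unfolding dist .
        also have "\<dots> \<le> M * ((r - s) * norm Q * M)"
          using s r M by (intro mult_mono mult_left_mono disc) (auto simp: norm_mult)
        also have "\<dots> \<le> 1 / 4"
          using close by (simp add: power2_eq_square mult_ac)
        finally show ?thesis .
      qed
      then have "norm ((\<Sum>k<n. J (of_real r * ?u k) - J (of_real s * ?u k)) /\<^sub>R real n) \<le> 1 / 4"
        by (rule norm_mean_le[OF elim(2)])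
      then show ?thesis
        by (simp add: circle_mean_def sum_subtractf scaleR_diff_right)
    qed
    then have half: "norm (circle_mean n r - id_blinfun) \<le> 1 / 2"
      using at_s norm_triangle_ineq[of "circle_mean n r - circle_mean n s" "circle_mean n s - id_blinfun"]
      by simp
    have "X r = (circle_mean n r - id_blinfun) - ((circle_mean n r - id_blinfun) o\<^sub>L X r)"
      by (simp add: defect[symmetric] compose.diff_left)
    then have "norm (X r) \<le> norm (circle_mean n r - id_blinfun) + norm ((circle_mean n r - id_blinfun) o\<^sub>L X r)"
      by (metis norm_triangle_ineq4)
    also have "\<dots> \<le> 1 / 2 + 1 / 2 * norm (X r)"
      by (intro add_mono half order_trans[OF norm_blinfun_compose] mult_right_mono norm_ge_zero)
    finally show ?case
      using s r by (simp add: X_def)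
  qed
qed

text \<open>
  From radius \<open>s\<close> the previous step reaches boundedness at \<open>s + 2 \<eta>\<close>, hence convergence to 0 at
  \<open>s + \<eta>\<close> by comparison with a geometric sequence. Since \<open>\<eta>\<close> is the same for all radii up to \<open>\<rho> + 1\<close>,
  finitely many steps lead from 0 to \<open>\<rho>\<close>.
\<close>

lemma scaled_powers_tendsto_0:
  assumes "\<rho> \<ge> 0"
  shows "(\<lambda>n. \<rho> ^ n * norm (op_power Q n)) \<longlonglongrightarrow> 0"
proof -
  have shrink: "(\<lambda>n. s ^ n * norm (op_power Q n)) \<longlonglongrightarrow> 0"
    if "0 \<le> s" "s < r" and ev: "eventually (\<lambda>n. r ^ n * norm (op_power Q n) \<le> 1) sequentially" for s r
  proof (rule Lim_null_comparison)
    show "(\<lambda>n. (s / r) ^ n) \<longlonglongrightarrow> 0"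
      using that by (intro LIMSEQ_power_zero) simp
    from ev show "eventually (\<lambda>n. norm (s ^ n * norm (op_power Q n)) \<le> (s / r) ^ n) sequentially"
    proof eventually_elim
      case (elim n)
      have "s ^ n * norm (op_power Q n) = (s / r) ^ n * (r ^ n * norm (op_power Q n))"
        using that by (simp add: power_divide)
      also have "\<dots> \<le> (s / r) ^ n"
        using elim that by (intro mult_left_le) auto
      finally show ?case
        using that by simp
    qed
  qed
  define R where "R = \<rho> + 1"
  obtain M where M: "\<And>w. cmod w \<le> R \<Longrightarrow> norm (J w) \<le> M"
    using resolvent_bounded_on_disc by blast
  define L where "L = M\<^sup>2 * norm Q"
  have L: "L \<ge> 0"
    by (simp add: L_def)
  \<comment> \<open>Small enough that a step of length \<open>2 \<eta>\<close> satisfies the closeness condition of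
    \<open>power_radius_step\<close>, and that the last step stays within radius \<open>R\<close>.\<close>
  define \<eta> where "\<eta> = 1 / (8 * (L + 1))"
  have \<eta>: "0 < \<eta>" "\<eta> \<le> 1 / 2" "L * (2 * \<eta>) \<le> 1 / 4"
    using L by (auto simp: \<eta>_def field_simps)
  have steps: "(\<lambda>n. (real k * \<eta>) ^ n * norm (op_power Q n)) \<longlonglongrightarrow> 0" if "real k * \<eta> + \<eta> \<le> R" for k
    using that
  proof (induction k)
    case 0
    \<comment> \<open>The term for \<open>n = 0\<close> need not vanish, because \<open>0 ^ 0 = 1\<close>.\<close>
    have "eventually (\<lambda>n. (real 0 * \<eta>) ^ n * norm (op_power Q n) = 0) sequentially"
      using eventually_gt_at_top[of 0] by eventually_elim simp
    then show ?case
      by (rule tendsto_eventually)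
  next
    case (Suc k)
    have "eventually (\<lambda>n. (real k * \<eta> + 2 * \<eta>) ^ n * norm (op_power Q n) \<le> 1) sequentially"
    proof (rule power_radius_step[OF M])
      show "(\<lambda>n. (real k * \<eta>) ^ n * norm (op_power Q n)) \<longlonglongrightarrow> 0"
        using Suc \<eta>(1) by (simp add: algebra_simps)
      show "M\<^sup>2 * norm Q * (real k * \<eta> + 2 * \<eta> - real k * \<eta>) \<le> 1 / 4"
        using \<eta>(3) by (simp add: L_def)
      show "real k * \<eta> + 2 * \<eta> \<le> R"
        using Suc.prems by (simp add: algebra_simps)
    qed (use \<eta>(1) in auto)
    then show ?case
      by (rule shrink[rotated 2]) (use \<eta>(1) in \<open>auto simp: algebra_simps\<close>)
  qed
  define k where "k = nat \<lceil>\<rho> / \<eta>\<rceil>"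
  have "0 \<le> \<rho> / \<eta>"
    using assms \<eta>(1) by simp
  then have k: "\<rho> / \<eta> \<le> real k" "real k \<le> \<rho> / \<eta> + 1"
    unfolding k_def by linarith+
  have "\<rho> \<le> real k * \<eta>"
    using k(1) \<eta>(1) by (simp add: field_simps)
  have "real k * \<eta> + \<eta> \<le> R"
    using mult_right_mono[OF k(2), of \<eta>] \<eta> by (simp add: R_def distrib_right)
  show ?thesis
  proof (rule Lim_null_comparison[OF _ steps[OF \<open>real k * \<eta> + \<eta> \<le> R\<close>]])
    show "eventually (\<lambda>n. norm (\<rho> ^ n * norm (op_power Q n)) \<le> (real k * \<eta>) ^ n * norm (op_power Q n)) sequentially"
      using assms \<open>\<rho> \<le> real k * \<eta>\<close> by (intro always_eventually allI) (simp add: mult_right_mono power_mono)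
  qed
qed

end

text \<open>
  For \<open>w \<noteq> 0\<close> one has \<open>1 - w (A - z) = - w (A - (z + 1 / w))\<close>, and \<open>z + 1 / w\<close> lies outside the
  spectrum.
\<close>

lemma entire_resolvent_if_spectrum_singleton:
  assumes A: "A \<in> bops" and spec: "op_spectrum A \<subseteq> {z}"
  shows "\<exists>J. entire_resolvent (A - scalar_op z) J"
proof -
  define Q where "Q = A - scalar_op z"
  have "Q \<in> bops"
    unfolding Q_def by (intro bops_diff A bops_scalar_op)
  have "\<exists>J. J o\<^sub>L (id_blinfun - (scalar_op w o\<^sub>L Q)) = id_blinfun
      \<and> (id_blinfun - (scalar_op w o\<^sub>L Q)) o\<^sub>L J = id_blinfun" for w
  proof (cases "w = 0")
    case True
    then show ?thesis
      by (intro exI[of _ id_blinfun]) simp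
  next
    case False
    let ?B = "Q - scalar_op (1 / w)"
    have "z + 1 / w \<notin> op_spectrum A"
      using spec False by auto
    then obtain S where "S o\<^sub>L (A - scalar_op (z + 1 / w)) = id_blinfun"
      "(A - scalar_op (z + 1 / w)) o\<^sub>L S = id_blinfun"
      by (auto simp: op_spectrum_def)
    then have S: "S o\<^sub>L ?B = id_blinfun" "?B o\<^sub>L S = id_blinfun"
      by (simp_all add: Q_def scalar_op_add algebra_simps)
    have inv: "scalar_op w o\<^sub>L scalar_op (1 / w) = id_blinfun" "scalar_op (1 / w) o\<^sub>L scalar_op w = id_blinfun"
      using False by (simp_all flip: scalar_op_mult)
    have "id_blinfun - (scalar_op w o\<^sub>L Q) = - (scalar_op w o\<^sub>L ?B)"
      by (simp add: compose.diff_right inv)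
    moreover have "(S o\<^sub>L scalar_op (1 / w)) o\<^sub>L (scalar_op w o\<^sub>L ?B) = S o\<^sub>L ((scalar_op (1 / w) o\<^sub>L scalar_op w) o\<^sub>L ?B)"
      "(scalar_op w o\<^sub>L ?B) o\<^sub>L (S o\<^sub>L scalar_op (1 / w)) = scalar_op w o\<^sub>L ((?B o\<^sub>L S) o\<^sub>L scalar_op (1 / w))"
      by (simp_all only: compose_assoc)
    ultimately show ?thesis
      by (intro exI[of _ "- (S o\<^sub>L scalar_op (1 / w))"])
        (simp add: compose.minus_left compose.minus_right inv S)
  qed
  then obtain J where "\<And>w. J w o\<^sub>L (id_blinfun - (scalar_op w o\<^sub>L Q)) = id_blinfun
      \<and> (id_blinfun - (scalar_op w o\<^sub>L Q)) o\<^sub>L J w = id_blinfun"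
    by metis
  with \<open>Q \<in> bops\<close> show ?thesis
    unfolding Q_def[symmetric] by (intro exI[of _ J]) (simp add: entire_resolvent_def)
qed

lemma spectrum_singleton_power_bound:
  assumes "A \<in> bops" and "op_spectrum A \<subseteq> {z}" and "\<epsilon> > 0"
  shows "\<exists>C. \<forall>n. norm (op_power (A - scalar_op z) n) \<le> C * \<epsilon> ^ n"
proof -
  obtain J where "entire_resolvent (A - scalar_op z) J"
    using entire_resolvent_if_spectrum_singleton[OF assms(1,2)] by blast
  then have "(\<lambda>n. (1 / \<epsilon>) ^ n * norm (op_power (A - scalar_op z) n)) \<longlonglongrightarrow> 0"
    using assms(3) by (intro entire_resolvent.scaled_powers_tendsto_0) auto
  then have "Bseq (\<lambda>n. (1 / \<epsilon>) ^ n * norm (op_power (A - scalar_op z) n))"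
    by (intro convergent_imp_Bseq) (auto simp: convergent_def)
  then obtain C where "norm ((1 / \<epsilon>) ^ n * norm (op_power (A - scalar_op z) n)) \<le> C" for n
    by (auto simp: Bseq_def)
  then show ?thesis
    using assms(3) by (intro exI[of _ C]) (simp add: power_one_over field_simps)
qed

section \<open>Growth of the conjugation orbit\<close>

lemma inner_derivation_shift:
  assumes "T \<in> bops"
  shows "inner_derivation (A - scalar_op z) T = inner_derivation A T"
  using scalar_op_commute[OF assms, of z]
  by (simp add: inner_derivation_def compose.diff_left compose.diff_right)

lemma bops_inner_derivation_power:
  assumes "A \<in> bops" and "T \<in> bops"
  shows "(inner_derivation A ^^ n) T \<in> bops"
  by (induction n) (simp_all add: assms inner_derivation_def bops_diff bops_compose)

lemma inner_derivation_power_shift: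
  assumes "A \<in> bops" and "T \<in> bops"
  shows "(inner_derivation (A - scalar_op z) ^^ n) T = (inner_derivation A ^^ n) T"
  by (induction n) (simp_all add: inner_derivation_shift bops_inner_derivation_power[OF assms])

text \<open>
  The expansion of \<open>\<Delta>\<^sup>n T\<close> is estimated with \<open>Q = A - z\<close> in place of \<open>A\<close>, where the powers are small;
  its binomial coefficients add up to \<open>2\<^sup>n\<close>, which is absorbed by using the power bound for \<open>\<epsilon> / 2\<close>.
\<close>

lemma minimal_type_conjugation:
  assumes "A \<in> bops" and "T \<in> bops" and "op_spectrum A \<subseteq> {z}"
  shows "minimal_type (\<lambda>n. (inner_derivation A ^^ n) T /\<^sub>R fact n)"
  unfolding minimal_type_def
proof (intro allI impI)
  fix \<epsilon> :: real assume "\<epsilon> > 0"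
  then obtain C where C: "norm (op_power (A - scalar_op z) n) \<le> C * (\<epsilon> / 2) ^ n" for n
    using spectrum_singleton_power_bound[OF assms(1,3), of "\<epsilon> / 2"] by auto
  have "norm ((inner_derivation A ^^ n) T) \<le> (C\<^sup>2 * norm T) * \<epsilon> ^ n" for n
    using norm_inner_derivation_power_le[OF C, of n T]
    by (simp add: inner_derivation_power_shift[OF assms(1,2)])
  then show "\<exists>C. \<forall>n. fact n * norm ((inner_derivation A ^^ n) T /\<^sub>R fact n) \<le> C * \<epsilon> ^ n"
    by (intro exI[of _ "C\<^sup>2 * norm T"]) (simp flip: mult.assoc)
qed

lemma conj_growth_imp_derivation_power_zero:
  assumes "A \<in> bops" and "op_spectrum A \<subseteq> {z}" and "\<alpha> \<ge> 0"
    and T: "T \<in> conj_growth A \<alpha>" and n: "real n > \<alpha>"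
  shows "(inner_derivation A ^^ n) T = 0"
proof -
  obtain C where "T \<in> bops" and C: "\<And>t. norm (op_exp (t *\<^sub>R A) o\<^sub>L T o\<^sub>L op_exp (- (t *\<^sub>R A)))
      \<le> C * (1 + \<bar>t\<bar>) powr \<alpha>"
    using T by (auto simp: conj_growth_def)
  have "(inner_derivation A ^^ n) T /\<^sub>R fact n = 0"
  proof (rule polynomial_growth_imp_polynomial)
    show "minimal_type (\<lambda>n. (inner_derivation A ^^ n) T /\<^sub>R fact n)"
      using assms(1) \<open>T \<in> bops\<close> assms(2) by (rule minimal_type_conjugation)
    show "norm (\<Sum>n. t ^ n *\<^sub>R ((inner_derivation A ^^ n) T /\<^sub>R fact n)) \<le> C * (1 + \<bar>t\<bar>) powr \<alpha>" for t
      using C[of t] unfolding sums_unique[OF conjugation_by_exp_sums] .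
  qed fact+
  then show ?thesis
    by simp
qed

lemma derivation_power_zero_imp_conj_growth:
  assumes "T \<in> bops" and "\<alpha> \<ge> 0" and zero: "(inner_derivation A ^^ (nat \<lfloor>\<alpha>\<rfloor> + 1)) T = 0"
  shows "T \<in> conj_growth A \<alpha>"
proof -
  define m where "m = nat \<lfloor>\<alpha>\<rfloor> + 1"
  have below: "real k \<le> \<alpha>" if "k < m" for k
    using that assms(2) unfolding m_def by linarith
  define a where "a = (\<lambda>n. (inner_derivation A ^^ n) T /\<^sub>R fact n)"
  have vanish: "a n = 0" if "n \<ge> m" for n
  proof -
    have "(inner_derivation A ^^ (k + m)) T = 0" for k
    proof (induction k)
      case 0
      show ?case
        using zero by (simp only: m_def add_0_left)
    next
      case (Suc k)
      then show ?case
        by (simp add: inner_derivation_def)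
    qed
    from this[of "n - m"] show ?thesis
      using that by (simp add: a_def)
  qed
  \<comment> \<open>The summand 1 makes the constant positive even if all coefficients vanish.\<close>
  have bound: "norm (op_exp (t *\<^sub>R A) o\<^sub>L T o\<^sub>L op_exp (- (t *\<^sub>R A)))
      \<le> ((\<Sum>n<m. norm (a n)) + 1) * (1 + \<bar>t\<bar>) powr \<alpha>" for t
  proof -
    have "op_exp (t *\<^sub>R A) o\<^sub>L T o\<^sub>L op_exp (- (t *\<^sub>R A)) = (\<Sum>n. t ^ n *\<^sub>R a n)"
      using sums_unique[OF conjugation_by_exp_sums] by (simp add: a_def)
    also have "\<dots> = (\<Sum>n<m. t ^ n *\<^sub>R a n)"
      by (rule suminf_finite) (auto simp: vanish)
    also have "norm \<dots> \<le> (\<Sum>n<m. norm (a n) * (1 + \<bar>t\<bar>) powr \<alpha>)"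
    proof (rule sum_norm_le)
      fix n assume "n \<in> {..<m}"
      then have "(1 + \<bar>t\<bar>) powr real n \<le> (1 + \<bar>t\<bar>) powr \<alpha>"
        using below by (intro powr_mono) auto
      moreover have "\<bar>t\<bar> ^ n \<le> (1 + \<bar>t\<bar>) powr real n"
        by (subst powr_realpow) (auto intro!: power_mono)
      ultimately show "norm (t ^ n *\<^sub>R a n) \<le> norm (a n) * (1 + \<bar>t\<bar>) powr \<alpha>"
        by (simp add: power_abs mult.commute mult_left_mono)
    qed
    also have "\<dots> \<le> ((\<Sum>n<m. norm (a n)) + 1) * (1 + \<bar>t\<bar>) powr \<alpha>"
      by (simp add: distrib_right flip: sum_distrib_right)
    finally show ?thesis .
  qed
  have "(\<Sum>n<m. norm (a n)) + 1 > 0"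
    by (simp add: add_nonneg_pos sum_nonneg)
  with assms(1) bound show ?thesis
    unfolding conj_growth_def by blast
qed

theorem theorem2p1:
  fixes A :: "'a::complex_banach \<Rightarrow>\<^sub>L 'a" and \<alpha> :: real
  assumes "A \<in> bops"
    and "\<alpha> \<ge> 0"
    and "\<exists>z. op_spectrum A = {z}"
  shows "conj_growth A \<alpha> = ker_derivation_power A (nat \<lfloor>\<alpha>\<rfloor> + 1)
    \<and> (\<alpha> < 1 \<longrightarrow> conj_growth A \<alpha> = commutant A)"
proof -
  obtain z where z: "op_spectrum A \<subseteq> {z}"
    using assms(3) by blast
  have "real (nat \<lfloor>\<alpha>\<rfloor> + 1) > \<alpha>"
    using assms(2) by linarith
  then have "T \<in> ker_derivation_power A (nat \<lfloor>\<alpha>\<rfloor> + 1)" if "T \<in> conj_growth A \<alpha>" for T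
    using conj_growth_imp_derivation_power_zero[OF assms(1) z assms(2) that] that
    unfolding ker_derivation_power_def conj_growth_def by blast
  moreover have "T \<in> conj_growth A \<alpha>" if "T \<in> ker_derivation_power A (nat \<lfloor>\<alpha>\<rfloor> + 1)" for T
    using that derivation_power_zero_imp_conj_growth[OF _ assms(2)]
    unfolding ker_derivation_power_def by blast
  ultimately have "conj_growth A \<alpha> = ker_derivation_power A (nat \<lfloor>\<alpha>\<rfloor> + 1)"
    by blast
  moreover have "ker_derivation_power A (nat \<lfloor>\<alpha>\<rfloor> + 1) = commutant A" if "\<alpha> < 1"
  proof -
    have "nat \<lfloor>\<alpha>\<rfloor> = 0"
      using that by linarith
    then show ?thesis
      by (simp add: ker_derivation_power_def commutant_def inner_derivation_def)
  qed
  ultimately show ?thesis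
    by simp
qed

end
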